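(* Let $E\in\mathcal{I}_{\mathcal{R}}$, i.e. $E\subset \mathbb{H}^n$ is a compact rotationally invariant set that is isodiametric within the class of rotationally invariant sets. Then its Steiner symmetrization with respect to the $\mathbb{C}^n$-plane satisfies $\operatorname{St}E\in\mathcal{I}_{\mathcal{R}}$ and $\operatorname{St}E=A_{\operatorname{diam}E}$.
   Context: Let $n\ge 1$. The Heisenberg group is $\mathbb{H}^n=\mathbb{C}^n\times\mathbb{R}\approx\mathbb{R}^{2n+1}$ with points $[z,t]$, $z=(z_1,\dots,z_n)$, $z_j=x_j+iy_j$, and group law $[z,t]\cdot[z',t']=[z+z',\,t+t'+2\operatorname{Im} z\overline{z}']$, where $\operatorname{Im} z\overline z'=\sum_j\operatorname{Im} z_j\overline{z}'_j$. Put $X_j=\partial_{x_j}+2y_j\partial_t$, $Y_j=\partial_{y_j}-2x_j\partial_t$. A curve is horizontal if it is absolutely continuous and its tangent vector lies a.e. in $\operatorname{span}\{X_j,Y_j\}_{j}$. Fix the left-invariant Riemannian metric making $(X_1,\dots,X_n,Y_1,\dots,Y_n,\partial_t)$ orthonormal; the Carnot-Carathéodory distance $d(p,q)$ is the infimum of the Riemannian lengths of horizontal curves joining $p$ to $q$. Diameters are with respect to $d$; $\mathcal{L}^{2n+1}$ is Lebesgue (outer) measure on $\mathbb{R}^{2n+1}$; $\pi([z,t])=z$; $\|z\|=(\sum_j|z_j|^2)^{1/2}$. For $\theta\in\mathbb{R}^n$ let $r_\theta([z,t])=[(e^{i\theta_1}z_1,\dots,e^{i\theta_n}z_n),t]$,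 and let $\mathcal{R}=\{F\subset\mathbb{H}^n : r_\theta(F)\subset F\text{ for all }\theta\in\mathbb{R}^n\}$ (rotationally invariant sets). $C_{I,\mathcal{R}}=\sup\{\mathcal{L}^{2n+1}(F)/(\operatorname{diam}F)^{2n+2} : F\in\mathcal{R},\ 0<\operatorname{diam}F<+\infty\}$, and $\mathcal{I}_{\mathcal{R}}=\{E\in\mathcal{R} : E\text{ compact},\ \operatorname{diam}E>0,\ \mathcal{L}^{2n+1}(E)=C_{I,\mathcal{R}}(\operatorname{diam}E)^{2n+2}\}$. For a measurable $F\subset\mathbb{H}^n$, its Steiner symmetrization with respect to the $\mathbb{C}^n$-plane is $\operatorname{St}F=\{[z,t] : z\in\pi(F),\ 2|t|\le\mathcal{L}^1(\{s\in\mathbb{R} : [z,s]\in F\})\}$. The sets $A_\lambda$: let $\rho:[0,\pi]\to[0,1]$, $\rho(\varphi)=\frac{\sin\varphi}{\varphi}$ for $\varphi>0$, $\rho(0)=1$ (a decreasing bijection); let $g(\varphi)=\frac{2\varphi-\sin(2\varphi)}{2\varphi^2}$ for $0<\varphi\le\pi$, $g(0)=0$; let $h=g\circ\rho^{-1}:[0,1]\to\mathbb{R}$ and, for $\mu>0$ and $r\in[0,\mu]$, $h_\mu(r)=\mu^2h(r/\mu)$. For $\lambda>0$ set $l_\lambda(r)=\frac{\lambda^2}{2\pi}$ if $r\in[0,\lambda/\pi]$ and $l_\lambda(r)=h_{\lambda/2}(r)$ if $r\in[\lambda/\pi,\lambda/2]$, and $A_\lambda=\{[z,t]\in\mathbb{H}^n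 : 2\|z\|\le\lambda,\ |t|\le l_\lambda(\|z\|)\}$. *)

theory Defs
  imports "HOL-Analysis.Analysis"
begin

section \<open>The Heisenberg group\<close>

text \<open>
  The index type \<open>'n\<close> plays the role of $\{1,\dots,n\}$ with $n = $ \<open>CARD('n)\<close> $\ge 1$. The library's
  Euclidean structure, topology and Lebesgue measure on this product type are those of
  $\mathbb{R}^{2n+1}$; all tangent spaces are identified with the type itself.
\<close>

type_synonym 'n heis = "(complex, 'n) vec \<times> real"

definition im_form :: "complex ^ 'n \<Rightarrow> complex ^ 'n \<Rightarrow> real" where
  "im_form z z' = (\<Sum>j\<in>UNIV. Im (z $ j * cnj (z' $ j)))"

definition heis_mult :: "'n::finite heis \<Rightarrow> 'n heis \<Rightarrow> 'n heis" where
  "heis_mult p q = (fst p + fst q, snd p + snd q + 2 * im_form (fst p) (fst q))"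

definition X_field :: "'n \<Rightarrow> 'n::finite heis \<Rightarrow> 'n heis" where
  "X_field j p = (axis j 1, 2 * Im (fst p $ j))"

definition Y_field :: "'n \<Rightarrow> 'n::finite heis \<Rightarrow> 'n heis" where
  "Y_field j p = (axis j \<i>, - 2 * Re (fst p $ j))"

definition T_field :: "'n::finite heis \<Rightarrow> 'n heis" where
  "T_field p = (0, 1)"

definition horizontal_space :: "'n::finite heis \<Rightarrow> 'n heis set" where
  "horizontal_space p = span (range (\<lambda>j. X_field j p) \<union> range (\<lambda>j. Y_field j p))"

text \<open>
  The coefficients of a tangent vector $(w,s)$ at $p=[z,t]$ in the frame $X_j, Y_j, \partial_t$ are
  $\mathrm{Re}\,w_j$, $\mathrm{Im}\,w_j$ and
  $s - 2\sum_j (y_j\,\mathrm{Re}\,w_j - x_j\,\mathrm{Im}\,w_j) = s - 2\,\mathrm{Im}\,z\overline{w}$.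
  \<open>heis_inner p\<close> is the metric at $p$; the lemmas below show that the frame is orthonormal and
  spanning (so that it determines the metric), and that the metric is left-invariant.
\<close>

definition T_coeff :: "'n::finite heis \<Rightarrow> 'n heis \<Rightarrow> real" where
  "T_coeff p v = snd v - 2 * im_form (fst p) (fst v)"

definition heis_inner :: "'n::finite heis \<Rightarrow> 'n heis \<Rightarrow> 'n heis \<Rightarrow> real" where
  "heis_inner p v v' =
     (\<Sum>j\<in>UNIV. Re (fst v $ j) * Re (fst v' $ j) + Im (fst v $ j) * Im (fst v' $ j))
     + T_coeff p v * T_coeff p v'"

definition heis_norm :: "'n::finite heis \<Rightarrow> 'n heis \<Rightarrow> real" where
  "heis_norm p v = sqrt (heis_inner p v v)"

lemma T_coeff_frame:
  "T_coeff p (X_field j p) = 0" "T_coeff p (Y_field j p) = 0" "T_coeff p (T_field p) = 1"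
proof -
  have "(\<Sum>k\<in>UNIV. Im (fst p $ k * cnj (axis j c $ k))) = Im (fst p $ j * cnj c)" for c
    by (subst sum.remove[of _ j]) (auto simp: axis_def intro!: sum.neutral)
  then show "T_coeff p (X_field j p) = 0" "T_coeff p (Y_field j p) = 0" "T_coeff p (T_field p) = 1"
    by (simp_all add: T_coeff_def X_field_def Y_field_def T_field_def im_form_def)
qed

lemma heis_frame_orthonormal:
  "heis_inner p (X_field j p) (X_field k p) = (if j = k then 1 else 0)"
  "heis_inner p (Y_field j p) (Y_field k p) = (if j = k then 1 else 0)"
  "heis_inner p (X_field j p) (Y_field k p) = 0"
  "heis_inner p (X_field j p) (T_field p) = 0"
  "heis_inner p (Y_field j p) (T_field p) = 0"
  "heis_inner p (T_field p) (T_field p) = 1"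
proof -
  have sum2: "(\<Sum>i\<in>UNIV. Re (axis j a $ i) * Re (axis k b $ i) + Im (axis j a $ i) * Im (axis k b $ i))
      = (if j = k then Re a * Re b + Im a * Im b else 0)" for a b
    by (subst sum.remove[of _ j]) (auto simp: axis_def intro!: sum.neutral)
  show "heis_inner p (X_field j p) (X_field k p) = (if j = k then 1 else 0)"
    "heis_inner p (Y_field j p) (Y_field k p) = (if j = k then 1 else 0)"
    "heis_inner p (X_field j p) (Y_field k p) = 0"
    unfolding heis_inner_def T_coeff_frame
    by (simp_all add: X_field_def Y_field_def sum2)
  show "heis_inner p (X_field j p) (T_field p) = 0"
    "heis_inner p (Y_field j p) (T_field p) = 0"
    "heis_inner p (T_field p) (T_field p) = 1"
    unfolding heis_inner_def T_coeff_frame by (simp_all add: T_field_def)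
qed

lemma heis_frame_expansion:
  "v = (\<Sum>j\<in>UNIV. Re (fst v $ j) *\<^sub>R X_field j p + Im (fst v $ j) *\<^sub>R Y_field j p)
       + T_coeff p v *\<^sub>R T_field p"
proof (rule prod_eqI)
  have "(\<Sum>j\<in>UNIV. Re (fst v $ j) *\<^sub>R axis j 1 $ i + Im (fst v $ j) *\<^sub>R axis j \<i> $ i) = fst v $ i" for i
    by (subst sum.remove[of _ i])
       (auto simp: axis_def complex_eq_iff intro!: sum.neutral)
  then show "fst v = fst ((\<Sum>j\<in>UNIV. Re (fst v $ j) *\<^sub>R X_field j p + Im (fst v $ j) *\<^sub>R Y_field j p)
       + T_coeff p v *\<^sub>R T_field p)"
    by (simp add: vec_eq_iff fst_sum X_field_def Y_field_def T_field_def)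
  show "snd v = snd ((\<Sum>j\<in>UNIV. Re (fst v $ j) *\<^sub>R X_field j p + Im (fst v $ j) *\<^sub>R Y_field j p)
       + T_coeff p v *\<^sub>R T_field p)"
    by (simp add: snd_sum X_field_def Y_field_def T_field_def T_coeff_def im_form_def
        sum_distrib_left algebra_simps)
qed

lemma heis_left_translation_derivative:
  "(heis_mult q has_derivative (\<lambda>v. (fst v, snd v + 2 * im_form (fst q) (fst v)))) (at p)"
proof -
  have "linear (im_form (fst q))"
    by (rule linearI) (simp_all add: im_form_def algebra_simps sum.distrib sum_distrib_left sum_subtractf)
  then have "bounded_linear (im_form (fst q))"
    by (rule linear_conv_bounded_linear[THEN iffD1])
  note [derivative_intros] = bounded_linear.has_derivative[OF this]
  have "((\<lambda>p. (fst q + fst p, snd q + snd p + 2 * im_form (fst q) (fst p)))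
          has_derivative (\<lambda>v. (fst v, snd v + 2 * im_form (fst q) (fst v)))) (at p)"
    by (auto intro!: derivative_eq_intros)
  then show ?thesis
    by (simp add: heis_mult_def[abs_def])
qed

lemma heis_inner_left_invariant:
  fixes q :: "'n::finite heis"
  defines "dL \<equiv> \<lambda>v. (fst v, snd v + 2 * im_form (fst q) (fst v))"
  shows "heis_inner (heis_mult q p) (dL v) (dL v') = heis_inner p v v'"
proof -
  have "T_coeff (heis_mult q p) (dL v) = T_coeff p v" for v
    by (simp add: T_coeff_def dL_def heis_mult_def im_form_def algebra_simps sum.distrib sum_distrib_left
        sum_subtractf)
  then show ?thesis
    by (simp add: heis_inner_def dL_def)
qed


section \<open>The Carnot-Caratheodory distance\<close>

text \<open>
  Absolute continuity on a set of reals: finite families of non-overlapping compact subintervals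
  are represented, as elsewhere in the library, by divisions of their own union.
\<close>

definition abs_continuous_on :: "real set \<Rightarrow> (real \<Rightarrow> 'a::real_normed_vector) \<Rightarrow> bool" where
  "abs_continuous_on S f \<longleftrightarrow>
     (\<forall>\<epsilon>>0. \<exists>\<delta>>0. \<forall>D. D division_of \<Union>D \<and> \<Union>D \<subseteq> S \<and> (\<Sum>K\<in>D. Sup K - Inf K) < \<delta> \<longrightarrow>
        (\<Sum>K\<in>D. norm (f (Sup K) - f (Inf K))) < \<epsilon>)"

definition horizontal_curve :: "real \<Rightarrow> real \<Rightarrow> (real \<Rightarrow> 'n::finite heis) \<Rightarrow> bool" where
  "horizontal_curve a b \<gamma> \<longleftrightarrow>
     a \<le> b \<and> abs_continuous_on {a..b} \<gamma> \<and>
     (AE s in lebesgue. s \<in> {a..b} \<longrightarrow>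
        (\<exists>v\<in>horizontal_space (\<gamma> s). (\<gamma> has_vector_derivative v) (at s)))"

definition curve_length :: "real \<Rightarrow> real \<Rightarrow> (real \<Rightarrow> 'n::finite heis) \<Rightarrow> ennreal" where
  "curve_length a b \<gamma> =
     (\<integral>\<^sup>+s\<in>{a..b}. ennreal (heis_norm (\<gamma> s) (vector_derivative \<gamma> (at s))) \<partial>lebesgue)"

definition cc_dist :: "'n::finite heis \<Rightarrow> 'n heis \<Rightarrow> ennreal" where
  "cc_dist p q =
     Inf {curve_length a b \<gamma> | a b \<gamma>. horizontal_curve a b \<gamma> \<and> \<gamma> a = p \<and> \<gamma> b = q}"

definition cc_diam :: "'n::finite heis set \<Rightarrow> ennreal" where
  "cc_diam F = (SUP p\<in>F. SUP q\<in>F. cc_dist p q)"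


section \<open>Rotationally invariant isodiametric sets\<close>

text \<open>Lebesgue measure of possibly non-measurable sets is outer measure.\<close>

abbreviation leb_outer :: "'a::euclidean_space set \<Rightarrow> ennreal" where
  "leb_outer \<equiv> outer_measure_of lebesgue"

definition rot :: "real ^ 'n \<Rightarrow> 'n::finite heis \<Rightarrow> 'n heis" where
  "rot \<theta> p = ((\<chi> j. cis (\<theta> $ j) * fst p $ j), snd p)"

definition rot_invariant :: "'n::finite heis set set" where
  "rot_invariant = {F. \<forall>\<theta>. rot \<theta> ` F \<subseteq> F}"

definition C_IR :: "'n::finite itself \<Rightarrow> ennreal" where
  "C_IR _ = (SUP F \<in> {F :: 'n heis set. F \<in> rot_invariant \<and> 0 < cc_diam F \<and> cc_diam F < \<infinity>}.
               leb_outer F / cc_diam F ^ (2 * CARD('n) + 2))"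

definition isodiametric_rot :: "'n::finite heis set set" where
  "isodiametric_rot = {E :: 'n heis set. E \<in> rot_invariant \<and> compact E \<and> 0 < cc_diam E \<and>
     leb_outer E = C_IR TYPE('n) * cc_diam E ^ (2 * CARD('n) + 2)}"


section \<open>Steiner symmetrization and the sets $A_\lambda$\<close>

definition steiner :: "'n::finite heis set \<Rightarrow> 'n heis set" where
  "steiner F = {(z, t). z \<in> fst ` F \<and> ennreal (2 * \<bar>t\<bar>) \<le> leb_outer {s. (z, s) \<in> F}}"

definition rho :: "real \<Rightarrow> real" where
  "rho \<phi> = (if \<phi> = 0 then 1 else sin \<phi> / \<phi>)"

definition g_fun :: "real \<Rightarrow> real" where
  "g_fun \<phi> = (if \<phi> = 0 then 0 else (2 * \<phi> - sin (2 * \<phi>)) / (2 * \<phi>\<^sup>2))"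

definition h_fun :: "real \<Rightarrow> real" where
  "h_fun r = g_fun (inv_into {0..pi} rho r)"

definition h_scaled :: "real \<Rightarrow> real \<Rightarrow> real" where
  "h_scaled \<mu> r = \<mu>\<^sup>2 * h_fun (r / \<mu>)"

definition l_fun :: "real \<Rightarrow> real \<Rightarrow> real" where
  "l_fun lam r = (if r \<le> lam / pi then lam\<^sup>2 / (2 * pi) else h_scaled (lam / 2) r)"

definition A_set :: "real \<Rightarrow> 'n::finite heis set" where
  "A_set lam = {(z, t). 2 * norm z \<le> lam \<and> \<bar>t\<bar> \<le> l_fun lam (norm z)}"

end

theory Submission
  imports Defs
begin

text \<open>
  For \<open>p = [z, t]\<close> and \<open>q = [z', t']\<close> put \<open>D = \<parallel>z' - z\<parallel>\<close> and \<open>T = t' - t - 2 Im z z'\<^sup>*\<close>. Both the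
  Carnot-Caratheodory distance and the sets \<open>A\<^sub>\<lambda>\<close> have a dual description by affine inequalities:
  \<open>d(p, q) \<le> l\<close> iff \<open>\<bar>T\<bar> \<le> l\<^sup>2 / \<phi> - D\<^sup>2 cot \<phi>\<close> for all \<open>0 < \<phi> < \<pi>\<close>, and \<open>[z, t] \<in> A\<^sub>\<lambda>\<close> iff
  \<open>\<bar>t\<bar> \<le> (\<lambda>/2)\<^sup>2 / \<phi> - \<parallel>z\<parallel>\<^sup>2 cot \<phi>\<close> for all \<open>0 < \<phi> \<le> \<pi>/2\<close>. The first one is the isoperimetric
  inequality for arcs: along a horizontal curve with arc length \<open>L\<close> the function
  \<open>\<plusminus>T + cot(c L + \<epsilon>) D\<^sup>2 - L / c\<close> is nonincreasing, and circular arcs give the converse.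

  In these terms \<open>diam A\<^sub>\<lambda> = \<lambda>\<close> reduces to \<open>\<parallel>z + e\<^sup>i\<^sup>\<phi> z'\<parallel>\<^sup>2 \<ge> 0\<close>. If
  \<open>E\<close> is rotationally invariant of diameter \<open>\<lambda>\<close>, then comparing \<open>[z, t]\<close> with \<open>[e\<^sup>i\<^sup>\<theta> z, s]\<close> for
  \<open>\<theta> = \<pi> - 2\<phi>\<close> shows that the slice of \<open>E\<close> over \<open>z\<close> has diameter at most \<open>2 l\<^sub>\<lambda>(\<parallel>z\<parallel>)\<close>, so that
  \<open>St E \<subseteq> A\<^sub>\<lambda>\<close>. Maximality of \<open>E\<close> makes the two measures equal; as \<open>St E\<close> is closed and \<open>A\<^sub>\<lambda>\<close> is the
  closure of its interior, the two sets coincide.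
\<close>

section \<open>Absolutely continuous curves\<close>

text \<open>A null set lies in an open set whose total length is below the \<open>d\<close> of
  absolute continuity. A gauge can force the intervals tagged in \<open>N\<close> into that set, so
  the increments over them have a small sum.\<close>

lemma abs_continuous_on_tagged:
  fixes f :: "real \<Rightarrow> 'a::real_normed_vector"
  assumes f: "abs_continuous_on {a..b} f" and N: "negligible N" and "0 < e"
  obtains U where "open U" "N \<subseteq> U"
    "\<And>p. p tagged_partial_division_of {a..b} \<Longrightarrow> (\<And>x K. (x, K) \<in> p \<Longrightarrow> K \<subseteq> U) \<Longrightarrow>
      (\<Sum>(x, K)\<in>p. norm (f (Sup K) - f (Inf K))) < e"
proof -
  obtain d where "0 < d" and d: "\<And>D. D division_of \<Union>D \<Longrightarrow> \<Union>D \<subseteq> {a..b} \<Longrightarrow>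
      (\<Sum>K\<in>D. Sup K - Inf K) < d \<Longrightarrow> (\<Sum>K\<in>D. norm (f (Sup K) - f (Inf K))) < e"
    using f[unfolded abs_continuous_on_def, rule_format, OF \<open>0 < e\<close>] by blast
  obtain U where U: "open U" "N \<subseteq> U" "U - N \<in> lmeasurable" "emeasure lebesgue (U - N) < ennreal d"
    using sets_lebesgue_outer_open[OF negligible_imp_sets[OF N] \<open>0 < d\<close>] by blast
  have NL: "N \<in> lmeasurable" by (rule negligible_imp_measurable[OF N])
  have UN: "(U - N) \<union> N = U" using U(2) by blast
  have Um: "U \<in> lmeasurable" using fmeasurable.Un[OF U(3) NL] by (simp only: UN)
  have "measure lebesgue U \<le> measure lebesgue (U - N) + measure lebesgue N"
    using measure_Un_le[of "U - N" lebesgue N] U(3) NL by (simp only: UN fmeasurableD)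
  also have "measure lebesgue N = 0" by (rule negligible_imp_measure0[OF N])
  also have "measure lebesgue (U - N) < d"
    using U(3,4) \<open>0 < d\<close> by (simp add: emeasure_eq_measure2 ennreal_less_iff)
  finally have Ud: "measure lebesgue U < d" by simp
  show thesis
  proof (rule that[OF U(1,2)])
    fix p assume p: "p tagged_partial_division_of {a..b}" and KU: "\<And>x K. (x, K) \<in> p \<Longrightarrow> K \<subseteq> U"
    let ?D = "snd ` p"
    have D: "?D division_of \<Union>?D"
      by (rule partial_division_of_tagged_division[OF p])
    have K: "\<exists>u v. K = {u..v} \<and> u \<le> v" if "K \<in> ?D" for K
      using division_ofD(3,4)[OF D that] by fastforce
    have "(\<Sum>K\<in>?D. Sup K - Inf K) = (\<Sum>K\<in>?D. measure lebesgue K)"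
    proof (rule sum.cong[OF refl])
      fix K assume "K \<in> ?D"
      then obtain u v where "K = {u..v}" "u \<le> v" using K by blast
      then show "Sup K - Inf K = measure lebesgue K" by simp
    qed
    also have "\<dots> = measure lebesgue (\<Union>?D)"
      by (rule content_division[OF D])
    also have "\<dots> \<le> measure lebesgue U"
    proof (rule measure_mono_fmeasurable[OF _ _ Um])
      show "\<Union>?D \<subseteq> U" using KU by fastforce
      show "\<Union>?D \<in> sets lebesgue" using lmeasurable_division[OF D] by (rule fmeasurableD)
    qed
    finally have "(\<Sum>K\<in>?D. Sup K - Inf K) < d" using Ud by simp
    moreover have "\<Union>?D \<subseteq> {a..b}"
      using tagged_partial_division_ofD(3)[OF p] by fastforce
    ultimately have "(\<Sum>K\<in>?D. norm (f (Sup K) - f (Inf K))) < e"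
      using d[OF D] by blast
    moreover have "(\<Sum>(x, K)\<in>p. norm (f (Sup K) - f (Inf K))) = (\<Sum>K\<in>?D. norm (f (Sup K) - f (Inf K)))"
    proof -
      \<comment> \<open>\<open>Sup\<close> and \<open>Inf\<close> of the empty real set are unspecified.\<close>
      let ?d = "\<lambda>K. if K = {} then 0 else norm (f (Sup K) - f (Inf K))"
      have ne: "K \<noteq> {}" if "K \<in> ?D" for K using K[OF that] by auto
      have "(\<Sum>(x, K)\<in>p. norm (f (Sup K) - f (Inf K))) = (\<Sum>(x, K)\<in>p. ?d K)"
      proof (rule sum.cong[OF refl])
        fix y assume "y \<in> p"
        then have "snd y \<noteq> {}" by (intro ne) simp
        then show "(case y of (x, K) \<Rightarrow> norm (f (Sup K) - f (Inf K))) = (case y of (x, K) \<Rightarrow> ?d K)"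
          by (simp add: split_def)
      qed
      also have "\<dots> = (\<Sum>K\<in>?D. ?d K)"
      proof (rule sum.over_tagged_division_lemma[OF tagged_partial_division_of_Union_self[OF p]])
        fix u v :: real assume "box u v = {}"
        then show "?d (cbox u v) = 0" by (cases "u = v") (auto simp: box_eq_empty)
      qed
      also have "\<dots> = (\<Sum>K\<in>?D. norm (f (Sup K) - f (Inf K)))"
        by (rule sum.cong) (use ne in auto)
      finally show ?thesis .
    qed
    ultimately show "(\<Sum>(x, K)\<in>p. norm (f (Sup K) - f (Inf K))) < e" by simp
  qed
qed

lemma abs_continuous_on_imp_continuous_on:
  fixes f :: "real \<Rightarrow> 'a::real_normed_vector"
  assumes f: "abs_continuous_on {a..b} f"
  shows "continuous_on {a..b} f"
  unfolding continuous_on_iff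
proof (intro ballI allI impI)
  fix x e :: real assume x: "x \<in> {a..b}" and "0 < e"
  obtain d where "0 < d" and d: "\<And>D. D division_of \<Union>D \<Longrightarrow> \<Union>D \<subseteq> {a..b} \<Longrightarrow>
      (\<Sum>K\<in>D. Sup K - Inf K) < d \<Longrightarrow> (\<Sum>K\<in>D. norm (f (Sup K) - f (Inf K))) < e"
    using f[unfolded abs_continuous_on_def, rule_format, OF \<open>0 < e\<close>] by blast
  have *: "dist (f v) (f u) < e" if "u \<in> {a..b}" "v \<in> {a..b}" "u \<le> v" "v - u < d" for u v
  proof -
    have "{{u..v}} division_of \<Union>{{u..v}}"
      using division_of_self[of u v] that by simp
    from d[OF this] show ?thesis
      using that by (simp add: dist_norm)
  qed
  show "\<exists>d>0. \<forall>y\<in>{a..b}. dist y x < d \<longrightarrow> dist (f y) (f x) < e"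
  proof (intro exI[of _ d] conjI ballI impI \<open>0 < d\<close>)
    fix y assume "y \<in> {a..b}" "dist y x < d"
    then show "dist (f y) (f x) < e"
      using *[of x y] *[of y x] x by (cases "x \<le> y") (auto simp: dist_commute dist_real_def)
  qed
qed

text \<open>
  Henstock's lemma compares the increments of \<open>L\<close> with \<open>m\<close> on a fine division, which replaces the
  almost everywhere differentiability of the indefinite integral \<open>L\<close>.
\<close>

lemma abs_continuous_calibration:
  fixes \<gamma> :: "real \<Rightarrow> 'a::euclidean_space" and m L :: "real \<Rightarrow> real" and \<Phi> :: "'a \<times> real \<Rightarrow> real"
  assumes "a \<le> b" and ac: "abs_continuous_on {a..b} \<gamma>"
    and m: "m integrable_on {a..b}" "\<And>s. s \<in> {a..b} \<Longrightarrow> 0 \<le> m s"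
    and L: "\<And>s. L s = integral {a..s} m"
    and diff: "\<And>s. s \<in> {a..b} \<Longrightarrow> (\<Phi> has_derivative \<Phi>' s) (at (\<gamma> s, L s))"
    and lip: "\<And>u v. u \<in> {a..b} \<Longrightarrow> v \<in> {a..b} \<Longrightarrow>
      \<bar>\<Phi> (\<gamma> v, L v) - \<Phi> (\<gamma> u, L u)\<bar> \<le> k * (norm (\<gamma> v - \<gamma> u) + \<bar>L v - L u\<bar>)"
    and bound: "\<And>s. s \<in> {a..b} \<Longrightarrow> \<bar>\<Phi>' s (0, 1)\<bar> \<le> k"
    and N: "negligible N"
    and slope: "\<And>s. s \<in> {a..b} - N \<Longrightarrow>
      \<exists>v. (\<gamma> has_vector_derivative v) (at s within {a..b}) \<and> \<Phi>' s (v, m s) \<le> 0"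
  shows "\<Phi> (\<gamma> b, L b) \<le> \<Phi> (\<gamma> a, L a)"
proof -
  define F where "F = (\<lambda>s. \<Phi> (\<gamma> s, L s))"
  have "0 \<le> k" using bound[of a] \<open>a \<le> b\<close> by force
  have Ldiff: "L v - L u = integral {u..v} m" if "u \<in> {a..b}" "v \<in> {a..b}" "u \<le> v" for u v
  proof -
    have "integral {a..u} m + integral {u..v} m = integral {a..v} m"
      by (rule Henstock_Kurzweil_Integration.integral_combine) (use that in \<open>auto intro: integrable_subinterval_real[OF m(1)]\<close>)
    then show ?thesis by (simp add: L)
  qed
  have Lmono: "L u \<le> L v" if "u \<in> {a..b}" "v \<in> {a..b}" "u \<le> v" for u v
  proof -
    have "0 \<le> integral {u..v} m"
      by (rule Henstock_Kurzweil_Integration.integral_nonneg) (use that m in \<open>auto intro: integrable_subinterval_real[OF m(1)]\<close>)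
    then show ?thesis using Ldiff[OF that] by simp
  qed
  have contL: "continuous_on {a..b} L"
    using indefinite_integral_continuous_1[OF m(1)] by (simp add: L)
  have contg: "continuous_on {a..b} \<gamma>"
    by (rule abs_continuous_on_imp_continuous_on[OF ac])
  have local: "\<exists>d>0. \<forall>u v. u \<in> {a..b} \<and> v \<in> {a..b} \<and> u \<le> x \<and> x \<le> v \<and> x - u < d \<and> v - x < d \<longrightarrow>
      F v - F u \<le> e * (v - u) + e * (L v - L u) + k * \<bar>L v - L u - (v - u) * m x\<bar>"
    if x: "x \<in> {a..b} - N" and "0 < e" for x e
  proof -
    have xab: "x \<in> {a..b}" using x by simp
    obtain g where g: "(\<gamma> has_vector_derivative g) (at x within {a..b})" and sl: "\<Phi>' x (g, m x) \<le> 0"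
      using slope[OF x] by blast
    have bl: "bounded_linear (\<Phi>' x)"
      using diff[OF xab] by (rule has_derivative_bounded_linear)
    obtain c where "0 < c" and c: "\<And>y. norm (\<Phi>' x y) \<le> norm y * c"
      using bounded_linear.pos_bounded[OF bl] by blast
    \<comment> \<open>\<open>\<eta>\<close> controls the remainder of \<open>\<Phi>\<close>, with
      \<open>norm g + 1\<close> bounding the speed of \<open>\<gamma>\<close> near \<open>x\<close>.
      \<open>\<zeta>\<close> below controls the remainder of \<open>\<gamma>\<close>, which passes
      through \<open>\<Phi>' x\<close> at the cost of the factor \<open>c\<close>. Each contributes
      \<open>e / 2\<close>.\<close>
    define \<eta> where "\<eta> = min e (e / (2 * (norm g + 1)))"
    have g1: "norm g + 1 > 0" using norm_ge_zero[of g] by linarith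
    have "0 < \<eta>" using \<open>0 < e\<close> g1 by (simp add: \<eta>_def)
    have "\<eta> \<le> e" by (simp add: \<eta>_def)
    have "\<eta> * (norm g + 1) \<le> e / (2 * (norm g + 1)) * (norm g + 1)"
      using g1 by (intro mult_right_mono) (auto simp: \<eta>_def)
    also have "\<dots> = e / 2 / (norm g + 1) * (norm g + 1)" by simp
    also have "\<dots> = e / 2" using nonzero_eq_divide_eq[of "norm g + 1" "e / 2 / (norm g + 1)" "e / 2"] g1 by linarith
    finally have eta2: "\<eta> * (norm g + 1) \<le> e / 2" .
    define \<zeta> where "\<zeta> = min 1 (e / (2 * c))"
    have "0 < \<zeta>" "\<zeta> \<le> 1" using \<open>0 < e\<close> \<open>0 < c\<close> by (auto simp: \<zeta>_def)
    have zc: "\<zeta> * c \<le> e / 2"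
    proof -
      have "\<zeta> * c \<le> e / (2 * c) * c" using \<open>0 < c\<close> by (intro mult_right_mono) (auto simp: \<zeta>_def)
      then show ?thesis using \<open>0 < c\<close> by simp
    qed
    obtain d1 where "0 < d1" and d1: "\<And>y. norm (y - (\<gamma> x, L x)) < d1 \<Longrightarrow>
        norm (\<Phi> y - \<Phi> (\<gamma> x, L x) - \<Phi>' x (y - (\<gamma> x, L x))) \<le> \<eta> * norm (y - (\<gamma> x, L x))"
      using diff[OF xab] \<open>0 < \<eta>\<close> unfolding has_derivative_at_alt by blast
    obtain d2 where "0 < d2" and d2: "\<And>y. y \<in> {a..b} \<Longrightarrow> norm (y - x) < d2 \<Longrightarrow>
        norm (\<gamma> y - \<gamma> x - (y - x) *\<^sub>R g) \<le> \<zeta> * norm (y - x)"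
      using g \<open>0 < \<zeta>\<close> unfolding has_vector_derivative_def has_derivative_within_alt by blast
    have "continuous_on {a..b} (\<lambda>s. (\<gamma> s, L s))"
      using contg contL by (intro continuous_intros)
    then obtain d3 where "0 < d3" and d3: "\<And>y. y \<in> {a..b} \<Longrightarrow> dist y x < d3 \<Longrightarrow> dist (\<gamma> y, L y) (\<gamma> x, L x) < d1"
      using xab \<open>0 < d1\<close> unfolding continuous_on_iff by meson
    have one: "\<bar>F y - F x - (y - x) * \<Phi>' x (g, 0) - (L y - L x) * \<Phi>' x (0, 1)\<bar> \<le> e * \<bar>y - x\<bar> + e * \<bar>L y - L x\<bar>"
      if y: "y \<in> {a..b}" "\<bar>y - x\<bar> < min d2 d3" for y
    proof -
      define r where "r = \<gamma> y - \<gamma> x - (y - x) *\<^sub>R g"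
      have r: "norm r \<le> \<zeta> * \<bar>y - x\<bar>" using d2[of y] y by (simp add: r_def)
      have "norm ((\<gamma> y, L y) - (\<gamma> x, L x)) < d1"
        using d3[OF y(1)] y(2) by (simp add: dist_norm)
      from d1[OF this]
      have "\<bar>F y - F x - \<Phi>' x (\<gamma> y - \<gamma> x, L y - L x)\<bar> \<le> \<eta> * norm (\<gamma> y - \<gamma> x, L y - L x)"
        by (simp add: F_def)
      also have "norm (\<gamma> y - \<gamma> x, L y - L x) \<le> norm (\<gamma> y - \<gamma> x) + \<bar>L y - L x\<bar>"
        using norm_Pair_le[of "\<gamma> y - \<gamma> x" "L y - L x"] by simp
      also have "\<gamma> y - \<gamma> x = r + (y - x) *\<^sub>R g" by (simp add: r_def)
      also have "norm (r + (y - x) *\<^sub>R g) \<le> \<zeta> * \<bar>y - x\<bar> + \<bar>y - x\<bar> * norm g"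
        using r norm_triangle_ineq[of r "(y - x) *\<^sub>R g"] by simp
      also have "\<zeta> * \<bar>y - x\<bar> \<le> 1 * \<bar>y - x\<bar>" using \<open>\<zeta> \<le> 1\<close> by (intro mult_right_mono) auto
      finally have 1: "\<bar>F y - F x - \<Phi>' x (\<gamma> y - \<gamma> x, L y - L x)\<bar>
          \<le> \<eta> * (1 * \<bar>y - x\<bar> + \<bar>y - x\<bar> * norm g + \<bar>L y - L x\<bar>)"
        using \<open>0 < \<eta>\<close> by (simp add: r_def)
      have "\<eta> * (1 * \<bar>y - x\<bar> + \<bar>y - x\<bar> * norm g + \<bar>L y - L x\<bar>) = (\<eta> * (norm g + 1)) * \<bar>y - x\<bar> + \<eta> * \<bar>L y - L x\<bar>"
        by (simp add: algebra_simps)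
      also have "\<dots> \<le> e / 2 * \<bar>y - x\<bar> + e * \<bar>L y - L x\<bar>"
        using eta2 \<open>\<eta> \<le> e\<close> by (intro add_mono mult_right_mono) auto
      finally have 2: "\<bar>F y - F x - \<Phi>' x (\<gamma> y - \<gamma> x, L y - L x)\<bar> \<le> e / 2 * \<bar>y - x\<bar> + e * \<bar>L y - L x\<bar>"
        using 1 by linarith
      have "(\<gamma> y - \<gamma> x, L y - L x) = (r, 0) + (y - x) *\<^sub>R (g, 0) + (L y - L x) *\<^sub>R (0, 1)"
        by (simp add: r_def)
      then have 3: "\<Phi>' x (\<gamma> y - \<gamma> x, L y - L x) = \<Phi>' x (r, 0) + (y - x) * \<Phi>' x (g, 0) + (L y - L x) * \<Phi>' x (0, 1)"
        by (simp only: linear_add[OF bounded_linear.linear[OF bl]] linear_scale[OF bounded_linear.linear[OF bl]] real_scaleR_def)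
      have "\<bar>\<Phi>' x (r, 0)\<bar> \<le> norm r * c" using c[of "(r, 0)"] by simp
      also have "\<dots> \<le> \<zeta> * \<bar>y - x\<bar> * c" using r \<open>0 < c\<close> by (intro mult_right_mono) auto
      also have "\<dots> = \<zeta> * c * \<bar>y - x\<bar>" by simp
      also have "\<dots> \<le> e / 2 * \<bar>y - x\<bar>" using zc by (intro mult_right_mono) auto
      finally have "\<bar>\<Phi>' x (r, 0)\<bar> \<le> e / 2 * \<bar>y - x\<bar>" .
      then show ?thesis using 2 3 by linarith
    qed
    have "\<Phi>' x (g, m x) = \<Phi>' x ((g, 0) + m x *\<^sub>R (0, 1))" by simp
    also have "\<dots> = \<Phi>' x (g, 0) + m x * \<Phi>' x (0, 1)"
      by (simp only: linear_add[OF bounded_linear.linear[OF bl]] linear_scale[OF bounded_linear.linear[OF bl]] real_scaleR_def)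
    finally have sl': "\<Phi>' x (g, 0) \<le> - m x * \<Phi>' x (0, 1)" using sl by simp
    show ?thesis
    proof (intro exI[of _ "min d2 d3"] conjI allI impI)
      show "0 < min d2 d3" using \<open>0 < d2\<close> \<open>0 < d3\<close> by simp
      fix u v assume *: "u \<in> {a..b} \<and> v \<in> {a..b} \<and> u \<le> x \<and> x \<le> v \<and> x - u < min d2 d3 \<and> v - x < min d2 d3"
      have "\<bar>F u - F x - (u - x) * \<Phi>' x (g, 0) - (L u - L x) * \<Phi>' x (0, 1)\<bar> \<le> e * (x - u) + e * (L x - L u)"
        using one[of u] * Lmono[of u x] xab by auto
      moreover have "\<bar>F v - F x - (v - x) * \<Phi>' x (g, 0) - (L v - L x) * \<Phi>' x (0, 1)\<bar> \<le> e * (v - x) + e * (L v - L x)"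
        using one[of v] * Lmono[of x v] xab by auto
      ultimately have "F v - F u \<le> (v - u) * \<Phi>' x (g, 0) + (L v - L u) * \<Phi>' x (0, 1) + e * (v - u) + e * (L v - L u)"
        by (auto simp: algebra_simps)
      also have "(v - u) * \<Phi>' x (g, 0) \<le> (v - u) * (- m x * \<Phi>' x (0, 1))"
        using sl' * by (intro mult_left_mono) auto
      also have "(v - u) * (- m x * \<Phi>' x (0, 1)) + (L v - L u) * \<Phi>' x (0, 1) = (L v - L u - (v - u) * m x) * \<Phi>' x (0, 1)"
        by (simp add: algebra_simps)
      also have "\<dots> \<le> \<bar>L v - L u - (v - u) * m x\<bar> * k"
      proof -
        let ?y = "L v - L u - (v - u) * m x"
        have "?y * \<Phi>' x (0, 1) \<le> \<bar>?y\<bar> * \<bar>\<Phi>' x (0, 1)\<bar>" by (metis abs_ge_self abs_mult)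
        also have "\<dots> \<le> \<bar>?y\<bar> * k" using bound[OF xab] by (intro mult_left_mono) auto
        finally show ?thesis .
      qed
      finally show "F v - F u \<le> e * (v - u) + e * (L v - L u) + k * \<bar>L v - L u - (v - u) * m x\<bar>"
        by (simp add: mult.commute)
    qed
  qed
  \<comment> \<open>The terms \<open>b - a\<close> and \<open>L b\<close> collect the local errors;
    one \<open>k\<close> comes from Henstock's lemma and the other from the increments of
    \<open>\<gamma>\<close> over intervals tagged in \<open>N\<close>.\<close>
  have le: "F b - F a \<le> e * (b - a + L b + 2 * k)" if "0 < e" for e
  proof -
    \<comment> \<open>With \<open>m\<close> set to 0 on \<open>N\<close>, the Henstock error of an
      interval tagged in \<open>N\<close> is the full increment of \<open>L\<close>, which is what
      the Lipschitz estimate needs there.\<close>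
    define m0 where "m0 = (\<lambda>s. if s \<in> N then 0 else m s)"
    have m0: "m0 integrable_on cbox a b"
      using integrable_spike[OF m(1) N, of m0] by (simp add: m0_def)
    have int0: "integral {u..v} m0 = integral {u..v} m" for u v
      by (rule integral_spike[OF N]) (simp add: m0_def)
    obtain G where G: "gauge G" and GH: "\<And>p. p tagged_partial_division_of cbox a b \<Longrightarrow> G fine p \<Longrightarrow>
        (\<Sum>(x,K)\<in>p. norm (measure lborel K *\<^sub>R m0 x - integral K m0)) < e"
      using Henstock_lemma[OF m0 \<open>0 < e\<close>] by blast
    obtain U where U: "open U" "N \<subseteq> U" and UN: "\<And>p. p tagged_partial_division_of {a..b} \<Longrightarrow> (\<And>x K. (x, K) \<in> p \<Longrightarrow> K \<subseteq> U) \<Longrightarrow>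
        (\<Sum>(x, K)\<in>p. norm (\<gamma> (Sup K) - \<gamma> (Inf K))) < e"
      using abs_continuous_on_tagged[OF ac N \<open>0 < e\<close>] by blast
    have "\<exists>d. \<forall>x. x \<in> {a..b} - N \<longrightarrow> 0 < d x \<and> (\<forall>u v. u \<in> {a..b} \<and> v \<in> {a..b} \<and> u \<le> x \<and> x \<le> v \<and> x - u < d x \<and> v - x < d x \<longrightarrow>
      F v - F u \<le> e * (v - u) + e * (L v - L u) + k * \<bar>L v - L u - (v - u) * m x\<bar>)"
      using local[OF _ \<open>0 < e\<close>] by (intro choice) blast
    then obtain d where d: "\<And>x. x \<in> {a..b} - N \<Longrightarrow> 0 < d x"
      and dF: "\<And>x u v. x \<in> {a..b} - N \<Longrightarrow> u \<in> {a..b} \<Longrightarrow> v \<in> {a..b} \<Longrightarrow> u \<le> x \<Longrightarrow> x \<le> v \<Longrightarrow> x - u < d x \<Longrightarrow> v - x < d x \<Longrightarrow>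
      F v - F u \<le> e * (v - u) + e * (L v - L u) + k * \<bar>L v - L u - (v - u) * m x\<bar>"
      by blast
    \<comment> \<open>The gauge serves Henstock's lemma everywhere, keeps intervals tagged in
      \<open>N\<close> inside the small open set, and elsewhere enforces the radius of the local
      estimate.\<close>
    define H where "H = (\<lambda>x. G x \<inter> (if x \<in> N then U else if x \<in> {a..b} then ball x (d x) else UNIV))"
    have "gauge H"
      using G U d unfolding gauge_def H_def by auto
    then obtain p where p: "p tagged_division_of {a..b}" and fine: "H fine p"
      using fine_division_exists_real by blast
    have pp: "p tagged_partial_division_of {a..b}"
      using p by (simp add: tagged_division_of_def)
    have "finite p" using p by blast
    have K: "\<exists>u v. K = {u..v} \<and> u \<le> v \<and> u \<in> {a..b} \<and> v \<in> {a..b} \<and> x \<in> {u..v}" if "(x, K) \<in> p" for x K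
      using tagged_division_ofD(2,3,4)[OF p that] by fastforce
    have each: "F (Sup K) - F (Inf K) \<le> e * measure lborel K + e * (L (Sup K) - L (Inf K))
        + k * norm (measure lborel K *\<^sub>R m0 x - integral K m0)
        + (if x \<in> N then k * norm (\<gamma> (Sup K) - \<gamma> (Inf K)) else 0)" if xK: "(x, K) \<in> p" for x K
    proof -
      obtain u v where uv: "K = {u..v}" "u \<le> v" "u \<in> {a..b}" "v \<in> {a..b}" "x \<in> {u..v}"
        using K[OF xK] by blast
      have LK: "integral K m0 = L v - L u" using int0 Ldiff uv by simp
      have KH: "K \<subseteq> H x" by (rule fineD[OF fine xK])
      show ?thesis
      proof (cases "x \<in> N")
        case True
        have "F v - F u \<le> k * (norm (\<gamma> v - \<gamma> u) + \<bar>L v - L u\<bar>)"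
          using lip[OF uv(3,4)] unfolding F_def by linarith
        moreover have "0 \<le> e * (v - u)" "0 \<le> e * (L v - L u)" using \<open>0 < e\<close> uv Lmono[of u v] by auto
        moreover have "norm (measure lborel K *\<^sub>R m0 x - integral K m0) = \<bar>L v - L u\<bar>"
          unfolding LK by (simp add: True m0_def abs_minus_commute)
        ultimately show ?thesis using True uv by (simp add: algebra_simps)
      next
        case False
        have x: "x \<in> {a..b} - N" using uv False by auto
        have "K \<subseteq> ball x (d x)"
          using KH x by (simp add: H_def)
        moreover have "u \<in> K" "v \<in> K" using uv by auto
        ultimately have "u \<in> ball x (d x)" "v \<in> ball x (d x)" by blast+
        then have "x - u < d x" "v - x < d x"
          using uv by (auto simp: dist_real_def)
        then have "F v - F u \<le> e * (v - u) + e * (L v - L u) + k * \<bar>L v - L u - (v - u) * m x\<bar>"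
          using dF[OF x] uv by auto
        moreover have "norm (measure lborel K *\<^sub>R m0 x - integral K m0) = \<bar>L v - L u - (v - u) * m x\<bar>"
          unfolding LK using False uv by (simp add: m0_def abs_minus_commute)
        ultimately show ?thesis using False uv by simp
      qed
    qed
    let ?q = "{xK \<in> p. fst xK \<in> N}"
    have qp: "?q tagged_partial_division_of {a..b}"
      by (rule tagged_partial_division_subset[OF pp]) auto
    have 1: "(\<Sum>(x, K)\<in>?q. norm (\<gamma> (Sup K) - \<gamma> (Inf K))) < e"
    proof (rule UN[OF qp])
      fix x K assume "(x, K) \<in> ?q"
      then show "K \<subseteq> U" using fineD[OF fine, of x K] by (simp add: H_def)
    qed
    have 2: "(\<Sum>(x,K)\<in>p. norm (measure lborel K *\<^sub>R m0 x - integral K m0)) < e"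
    proof (rule GH)
      show "p tagged_partial_division_of cbox a b" using pp by simp
      show "G fine p" using fineD[OF fine] by (intro fineI) (force simp: H_def)
    qed
    have "F b - F a = (\<Sum>(x, K)\<in>p. F (Sup K) - F (Inf K))"
      using additive_tagged_division_1[OF \<open>a \<le> b\<close> p, of F] by simp
    also have "\<dots> \<le> (\<Sum>(x, K)\<in>p. e * measure lborel K + e * (L (Sup K) - L (Inf K))
        + k * norm (measure lborel K *\<^sub>R m0 x - integral K m0)
        + (if x \<in> N then k * norm (\<gamma> (Sup K) - \<gamma> (Inf K)) else 0))"
      by (rule sum_mono) (use each in auto)
    also have "\<dots> = e * (\<Sum>(x, K)\<in>p. measure lborel K) + e * (\<Sum>(x, K)\<in>p. L (Sup K) - L (Inf K))
        + k * (\<Sum>(x, K)\<in>p. norm (measure lborel K *\<^sub>R m0 x - integral K m0))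
        + (\<Sum>(x, K)\<in>p. if x \<in> N then k * norm (\<gamma> (Sup K) - \<gamma> (Inf K)) else 0)"
      by (simp add: sum.distrib sum_distrib_left split_def)
    also have "(\<Sum>(x, K)\<in>p. if x \<in> N then k * norm (\<gamma> (Sup K) - \<gamma> (Inf K)) else 0)
        = k * (\<Sum>(x, K)\<in>?q. norm (\<gamma> (Sup K) - \<gamma> (Inf K)))"
      unfolding sum_distrib_left split_def by (rule sum.inter_filter[symmetric]) fact
    also have "(\<Sum>(x, K)\<in>p. L (Sup K) - L (Inf K)) = L b - L a"
      using additive_tagged_division_1[OF \<open>a \<le> b\<close> p, of L] by simp
    also have "(\<Sum>(x, K)\<in>p. measure lborel K) = b - a"
      using additive_content_tagged_division[of p a b] p \<open>a \<le> b\<close> by simp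
    also have "L a = 0" by (simp add: L)
    also have "e * (b - a) + e * (L b - 0) + k * (\<Sum>(x, K)\<in>p. norm (measure lborel K *\<^sub>R m0 x - integral K m0))
        + k * (\<Sum>(x, K)\<in>?q. norm (\<gamma> (Sup K) - \<gamma> (Inf K))) \<le> e * (b - a) + e * (L b - 0) + k * e + k * e"
      using 1 2 \<open>0 \<le> k\<close> by (intro add_mono mult_left_mono order_refl) simp_all
    finally show ?thesis by (simp add: algebra_simps)
  qed
  have "((\<lambda>e. e * (b - a + L b + 2 * k)) \<longlongrightarrow> 0 * (b - a + L b + 2 * k)) (at_right 0)"
    by (intro tendsto_intros)
  then have "F b - F a \<le> 0 * (b - a + L b + 2 * k)"
    by (rule tendsto_lowerbound) (auto intro: le eventually_at_right_less[THEN eventually_mono])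
  then show ?thesis by (simp add: F_def)
qed

section \<open>Horizontal vectors\<close>

lemma inner_cplx_vec:
  fixes u v :: "complex ^ 'n::finite"
  shows "u \<bullet> v = (\<Sum>j\<in>UNIV. Re (u $ j) * Re (v $ j) + Im (u $ j) * Im (v $ j))"
  by (simp add: inner_vec_def inner_complex_def)

lemma norm_cmult_vec:
  fixes u :: "complex ^ 'n::finite"
  shows "norm (\<chi> j. a * u $ j) = cmod a * norm u"
  by (simp add: norm_vec_def norm_mult L2_set_right_distrib)

lemma bounded_linear_im_form: "bounded_linear (im_form (z :: complex ^ 'n::finite))"
proof -
  have "linear (im_form z)"
    by (rule linearI) (simp_all add: im_form_def algebra_simps sum.distrib sum_distrib_left sum_subtractf)
  then show ?thesis by (rule linear_conv_bounded_linear[THEN iffD1])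
qed

lemma im_form_diff_left: "im_form (u - v) w = im_form u w - im_form v w"
  by (simp add: im_form_def algebra_simps sum.distrib sum_subtractf)

lemma im_form_diff_right: "im_form w (u - v) = im_form w u - im_form w v"
  by (simp add: im_form_def algebra_simps sum.distrib sum_subtractf)

lemma im_form_self [simp]: "im_form z z = 0"
  by (simp add: im_form_def)

text \<open>The left side is the real inner product of \<open>v\<close> with \<open>w\<close>
  multiplied by the unit scalar \<open>cis (- \<alpha>)\<close>, so this is the Cauchy-Schwarz
  inequality.\<close>

lemma rotated_inner_le:
  fixes w v :: "complex ^ 'n::finite"
  shows "cos \<alpha> * (w \<bullet> v) + sin \<alpha> * im_form w v \<le> norm w * norm v"
proof -
  have "cos \<alpha> * (w \<bullet> v) + sin \<alpha> * im_form w v = (\<chi> j. cis (- \<alpha>) * w $ j) \<bullet> v"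
    by (simp add: inner_cplx_vec im_form_def sum_distrib_left algebra_simps flip: sum.distrib)
  also have "\<dots> \<le> norm (\<chi> j. cis (- \<alpha>) * w $ j) * norm v"
    by (rule norm_cauchy_schwarz)
  finally show ?thesis by (simp add: norm_cmult_vec)
qed

lemma im_form_le: "\<bar>im_form w v\<bar> \<le> norm w * norm (v :: complex ^ 'n::finite)"
  using rotated_inner_le[of "pi / 2" w v] rotated_inner_le[of "- pi / 2" w v] by simp

lemma T_coeff_horizontal:
  assumes "v \<in> horizontal_space p"
  shows "T_coeff p v = 0"
  using assms unfolding horizontal_space_def
proof (induction rule: span_induct_alt)
  case base
  show ?case by (simp add: T_coeff_def im_form_def)
next
  case (step c x y)
  have "T_coeff p (c *\<^sub>R x + y) = c * T_coeff p x + T_coeff p y"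
    by (simp add: T_coeff_def im_form_def algebra_simps sum.distrib sum_distrib_left sum_subtractf)
  moreover have "T_coeff p x = 0" using step T_coeff_frame by blast
  ultimately show ?case using step by simp
qed

lemma horizontal_spaceI:
  assumes "snd v = 2 * im_form (fst p) (fst v)"
  shows "v \<in> horizontal_space p"
proof -
  have "T_coeff p v = 0" using assms by (simp add: T_coeff_def)
  then have "v = (\<Sum>j\<in>UNIV. Re (fst v $ j) *\<^sub>R X_field j p + Im (fst v $ j) *\<^sub>R Y_field j p)"
    using heis_frame_expansion[of v p] by simp
  also have "\<dots> \<in> horizontal_space p"
    unfolding horizontal_space_def
    by (intro span_sum span_add span_scale span_base) auto
  finally show ?thesis .
qed

lemma heis_norm_horizontal:
  assumes "v \<in> horizontal_space p"
  shows "heis_norm p v = norm (fst v)"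
  by (simp add: heis_norm_def heis_inner_def T_coeff_horizontal[OF assms] norm_eq_sqrt_inner inner_cplx_vec)

lemma heis_norm_nonneg: "0 \<le> heis_norm p v"
  by (simp add: heis_norm_def heis_inner_def sum_nonneg)

text \<open>Outside a null set the derivative is the limit of the difference quotients with step
  \<open>1 / Suc n\<close>, which are measurable because the curve is continuous.\<close>

lemma abs_continuous_on_vector_derivative_measurable:
  fixes \<gamma> :: "real \<Rightarrow> 'a::euclidean_space"
  assumes ac: "abs_continuous_on {a..b} \<gamma>"
    and ae: "AE s in lebesgue. s \<in> {a..b} \<longrightarrow> \<gamma> differentiable at s"
  shows "(\<lambda>s. indicat_real {a..b} s *\<^sub>R vector_derivative \<gamma> (at s)) \<in> borel_measurable lebesgue"
proof (cases "a \<le> b")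
  case False
  then show ?thesis by simp
next
  case True
  \<comment> \<open>The constant extension beyond the endpoints makes the difference quotients
    measurable on the whole line.\<close>
  define G where "G = (\<lambda>s. \<gamma> (max a (min b s)))"
  have G: "continuous_on UNIV G"
    unfolding G_def
    by (rule continuous_on_compose2[OF abs_continuous_on_imp_continuous_on[OF ac]])
      (use True in \<open>auto intro!: continuous_intros\<close>)
  define q where "q = (\<lambda>n s. indicat_real {a<..<b} s *\<^sub>R (real (Suc n) *\<^sub>R (G (s + 1 / real (Suc n)) - G s)))"
  have qm: "q n \<in> borel_measurable lebesgue" for n
  proof -
    have "continuous_on UNIV (\<lambda>s. real (Suc n) *\<^sub>R (G (s + 1 / real (Suc n)) - G s))"
      by (intro continuous_intros continuous_on_compose2[OF G]) auto
    then have "(\<lambda>s. real (Suc n) *\<^sub>R (G (s + 1 / real (Suc n)) - G s)) \<in> borel_measurable borel"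
      by (rule borel_measurable_continuous_onI)
    then have "q n \<in> borel_measurable borel"
      unfolding q_def by measurable
    then show ?thesis by (simp add: measurable_completion)
  qed
  obtain N where N: "N \<in> null_sets lebesgue" "\<And>s. s \<in> {a..b} \<Longrightarrow> s \<notin> N \<Longrightarrow> \<gamma> differentiable at s"
    using ae unfolding completion.AE_iff_null_sets by auto
  \<comment> \<open>Discarding the endpoints leaves points \<open>s < b\<close>, at which
    \<open>s + 1 / Suc n\<close> eventually stays inside the interval, where \<open>G\<close> agrees
    with \<open>\<gamma>\<close>.\<close>
  define M where "M = N \<union> {a, b}"
  have M: "M \<in> null_sets lebesgue" unfolding M_def using N(1)
    by (intro null_sets.Un) (auto simp: finite_imp_null_set_lborel null_sets_completionI)
  define f where "f = (\<lambda>s. if s \<in> M then 0 else indicat_real {a..b} s *\<^sub>R vector_derivative \<gamma> (at s))"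
  have lim: "(\<lambda>n. if s \<in> M then 0 else q n s) \<longlonglongrightarrow> f s" for s
  proof (cases "s \<in> {a<..<b} - M")
    case False
    then have "(if s \<in> M then 0 else q n s) = 0" "f s = 0" for n
      by (auto simp: f_def q_def M_def indicator_def)
    then show ?thesis by simp
  next
    case s: True
    then have "\<gamma> differentiable at s" using N(2)[of s] by (auto simp: M_def)
    then have "(\<gamma> has_vector_derivative vector_derivative \<gamma> (at s)) (at s)"
      by (simp add: vector_derivative_works)
    then have "((\<lambda>h. (\<gamma> (s + h) - \<gamma> s - h *\<^sub>R vector_derivative \<gamma> (at s)) /\<^sub>R \<bar>h\<bar>) \<longlongrightarrow> 0) (at 0)"
      unfolding has_vector_derivative_def has_derivative_at
      by (intro tendsto_norm_zero_cancel[of "\<lambda>h. (\<gamma> (s + h) - \<gamma> s - h *\<^sub>R vector_derivative \<gamma> (at s)) /\<^sub>R \<bar>h\<bar>"])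
        (simp add: divide_inverse_commute)
    moreover have "filterlim (\<lambda>n. 1 / real (Suc n)) (at 0) sequentially"
      unfolding filterlim_at using LIMSEQ_inverse_real_of_nat by (auto simp: inverse_eq_divide)
    ultimately have "(\<lambda>n. (\<gamma> (s + 1 / real (Suc n)) - \<gamma> s - (1 / real (Suc n)) *\<^sub>R vector_derivative \<gamma> (at s)) /\<^sub>R \<bar>1 / real (Suc n)\<bar>) \<longlonglongrightarrow> 0"
      by (rule filterlim_compose)
    then have "(\<lambda>n. real (Suc n) *\<^sub>R (\<gamma> (s + 1 / real (Suc n)) - \<gamma> s) - vector_derivative \<gamma> (at s)) \<longlonglongrightarrow> 0"
    proof (rule Lim_transform_eventually, intro always_eventually allI)
      fix n
      have *: "inverse \<bar>1 / real (Suc n)\<bar> = real (Suc n)" by simp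
      show "(\<gamma> (s + 1 / real (Suc n)) - \<gamma> s - (1 / real (Suc n)) *\<^sub>R vector_derivative \<gamma> (at s)) /\<^sub>R \<bar>1 / real (Suc n)\<bar>
          = real (Suc n) *\<^sub>R (\<gamma> (s + 1 / real (Suc n)) - \<gamma> s) - vector_derivative \<gamma> (at s)"
        unfolding * by (simp add: scaleR_diff_right del: of_nat_Suc)
    qed
    then have 1: "(\<lambda>n. real (Suc n) *\<^sub>R (\<gamma> (s + 1 / real (Suc n)) - \<gamma> s)) \<longlonglongrightarrow> vector_derivative \<gamma> (at s)"
      by (rule LIM_zero_cancel)
    have "\<forall>\<^sub>F n in sequentially. 1 / real (Suc n) < b - s"
      using s LIMSEQ_inverse_real_of_nat by (intro order_tendstoD(2)[of _ 0]) (auto simp: inverse_eq_divide)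
    then have "\<forall>\<^sub>F n in sequentially. real (Suc n) *\<^sub>R (\<gamma> (s + 1 / real (Suc n)) - \<gamma> s) = (if s \<in> M then 0 else q n s)"
    proof eventually_elim
      case (elim n)
      have "0 < 1 / real (Suc n)" by simp
      then have "a < s + 1 / real (Suc n)" "s + 1 / real (Suc n) < b"
        using elim s by (simp_all only: greaterThanLessThan_iff Diff_iff, linarith+)
      then have "G (s + 1 / real (Suc n)) = \<gamma> (s + 1 / real (Suc n))" "G s = \<gamma> s"
        using s by (auto simp: G_def)
      then show ?case using s by (simp add: q_def)
    qed
    then have "(\<lambda>n. if s \<in> M then 0 else q n s) \<longlonglongrightarrow> vector_derivative \<gamma> (at s)"
      using 1 by (rule Lim_transform_eventually[rotated])
    then show ?thesis using s by (simp add: f_def)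
  qed
  have [measurable]: "M \<in> sets lebesgue" using M by auto
  have "f \<in> borel_measurable lebesgue"
    by (rule borel_measurable_LIMSEQ_metric[OF _ lim]) (use qm in measurable)
  moreover have "AE s in lebesgue. f s = indicat_real {a..b} s *\<^sub>R vector_derivative \<gamma> (at s)"
    using AE_not_in[OF M] by eventually_elim (simp add: f_def)
  ultimately show ?thesis by (rule borel_measurable_AE)
qed

lemma cot_has_derivative:
  assumes "sin (c * l + e) \<noteq> 0"
  shows "((\<lambda>l. cot (c * l + e)) has_real_derivative - c / (sin (c * l + e))\<^sup>2) (at l)"
proof -
  have "((\<lambda>l. c * l + e) has_real_derivative c) (at l)" by (auto intro!: derivative_eq_intros)
  from DERIV_chain2[OF DERIV_cot[OF assms] this] show ?thesis by (simp add: divide_inverse mult.commute)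
qed

text \<open>Sine rises up to \<open>pi / 2\<close> and falls afterwards, so over an interval it is
  smallest at an endpoint.\<close>

lemma sin_ge_min:
  assumes "0 < e" "e \<le> x" "x \<le> y" "y < pi"
  shows "min (sin e) (sin y) \<le> sin x"
proof (cases "x \<le> pi / 2")
  case True
  then have "sin e \<le> sin x" using assms by (intro sin_monotone_2pi_le) auto
  then show ?thesis by simp
next
  case False
  then have "sin (pi - y) \<le> sin (pi - x)" using assms by (intro sin_monotone_2pi_le) auto
  then show ?thesis by simp
qed

text \<open>This is the sign of the derivative of the calibrating function along a horizontal
  velocity \<open>v\<close> at displacement \<open>w\<close>. The rotated Cauchy-Schwarz inequality,
  scaled by \<open>2 / sin \<alpha>\<close>, bounds the first two terms by
  \<open>2 * norm w / sin \<alpha> * norm v\<close>; expanding the square of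
  \<open>norm w / sin \<alpha> - 1 / c\<close> does the rest.\<close>

lemma calibration_slope:
  fixes w v :: "complex ^ 'n::finite"
  assumes c: "0 < c" and s: "0 < sin \<alpha>" and \<sigma>: "\<bar>\<sigma>\<bar> = 1"
  shows "2 * \<sigma> * im_form w v + cot \<alpha> * (2 * (w \<bullet> v)) - (c / (sin \<alpha>)\<^sup>2 * (norm w)\<^sup>2 + 1 / c) * norm v \<le> 0"
proof -
  have "cos \<alpha> * (w \<bullet> v) + \<sigma> * sin \<alpha> * im_form w v \<le> norm w * norm v"
    using rotated_inner_le[of \<alpha> w v] rotated_inner_le[of "- \<alpha>" w v] \<sigma> by (cases "\<sigma> = 1") (auto simp: abs_if split: if_splits)
  then have "(cos \<alpha> * (w \<bullet> v) + \<sigma> * sin \<alpha> * im_form w v) * (2 / sin \<alpha>) \<le> norm w * norm v * (2 / sin \<alpha>)"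
    using s by (intro mult_right_mono) auto
  moreover have "(cos \<alpha> * (w \<bullet> v) + \<sigma> * sin \<alpha> * im_form w v) * (2 / sin \<alpha>) = 2 * \<sigma> * im_form w v + cot \<alpha> * (2 * (w \<bullet> v))"
    using s by (simp add: cot_def field_simps)
  moreover have "2 * norm w / sin \<alpha> \<le> c / (sin \<alpha>)\<^sup>2 * (norm w)\<^sup>2 + 1 / c"
  proof -
    have "0 \<le> c * (norm w / sin \<alpha> - 1 / c)\<^sup>2" using c by simp
    also have "\<dots> = c / (sin \<alpha>)\<^sup>2 * (norm w)\<^sup>2 + 1 / c - 2 * norm w / sin \<alpha>"
      using c by (simp add: power2_diff power_divide distrib_left right_diff_distrib power2_eq_square[of c])
    finally show ?thesis by simp
  qed
  then have "2 * norm w / sin \<alpha> * norm v \<le> (c / (sin \<alpha>)\<^sup>2 * (norm w)\<^sup>2 + 1 / c) * norm v"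
    by (rule mult_right_mono) simp
  ultimately show ?thesis by (simp add: mult.commute mult.left_commute)
qed

text \<open>Turns the length, a nonnegative Lebesgue integral, into a gauge integral to which the
  calibration argument applies. Almost everywhere the speed is the norm of the planar velocity,
  which is measurable.\<close>

lemma horizontal_curve_speed_integrable:
  assumes h: "horizontal_curve a b \<gamma>" and fin: "curve_length a b \<gamma> < \<infinity>"
  defines "m \<equiv> \<lambda>s. heis_norm (\<gamma> s) (vector_derivative \<gamma> (at s))"
  shows "m integrable_on {a..b}" and "curve_length a b \<gamma> = ennreal (integral {a..b} m)"
proof -
  let ?V = "\<lambda>s. indicat_real {a..b} s *\<^sub>R vector_derivative \<gamma> (at s)"
  have ae: "AE s in lebesgue. s \<in> {a..b} \<longrightarrow> (\<exists>v\<in>horizontal_space (\<gamma> s). (\<gamma> has_vector_derivative v) (at s))"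
    using h by (simp add: horizontal_curve_def)
  have meas: "?V \<in> borel_measurable lebesgue"
  proof (rule abs_continuous_on_vector_derivative_measurable)
    show "abs_continuous_on {a..b} \<gamma>" using h by (simp add: horizontal_curve_def)
    show "AE s in lebesgue. s \<in> {a..b} \<longrightarrow> \<gamma> differentiable at s"
      using ae by eventually_elim (auto intro: differentiableI_vector)
  qed
  have eq: "AE s in lebesgue. norm (fst (?V s)) = indicat_real {a..b} s * m s"
    using ae
  proof eventually_elim
    case (elim s)
    show ?case
    proof (cases "s \<in> {a..b}")
      case True
      then obtain v where "v \<in> horizontal_space (\<gamma> s)" "(\<gamma> has_vector_derivative v) (at s)"
        using elim by blast
      then show ?thesis using True
        by (simp add: m_def heis_norm_horizontal vector_derivative_at)
    qed simp
  qed
  have "(\<lambda>s. norm (fst (?V s))) \<in> borel_measurable lebesgue"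
    using meas by (rule measurable_compose) (intro borel_measurable_continuous_onI continuous_intros)
  then have mm: "(\<lambda>s. indicat_real {a..b} s * m s) \<in> borel_measurable lebesgue"
    using eq by (rule borel_measurable_AE)
  have nn: "0 \<le> indicat_real {a..b} s * m s" for s
    by (simp add: m_def heis_norm_nonneg)
  have len: "curve_length a b \<gamma> = (\<integral>\<^sup>+s. ennreal (indicat_real {a..b} s * m s) \<partial>lebesgue)"
    unfolding curve_length_def m_def by (intro nn_integral_cong) (auto simp: indicator_def)
  have int: "integrable lebesgue (\<lambda>s. indicat_real {a..b} s * m s)"
    using fin mm nn by (intro integrableI_nonneg) (auto simp: len)
  then have hi: "((\<lambda>s. indicat_real {a..b} s * m s) has_integral (\<integral>s. indicat_real {a..b} s * m s \<partial>lebesgue)) UNIV"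
    by (rule has_integral_integral_lebesgue)
  have "(\<lambda>s. indicat_real {a..b} s * m s) = (\<lambda>s. if s \<in> {a..b} then m s else 0)"
    by (auto simp: indicator_def)
  then have hi': "(m has_integral (\<integral>s. indicat_real {a..b} s * m s \<partial>lebesgue)) {a..b}"
    using hi by (simp only: has_integral_restrict_UNIV)
  then show "m integrable_on {a..b}" by blast
  show "curve_length a b \<gamma> = ennreal (integral {a..b} m)"
    unfolding len integral_unique[OF hi'] by (rule nn_integral_eq_integral[OF int]) (use nn in auto)
qed

section \<open>Bounds for the distance\<close>

lemma cot_antimono:
  assumes "0 < x" "x \<le> y" "y < pi"
  shows "cot y \<le> cot x"
proof -
  have "0 \<le> sin (y - x)" using assms by (intro sin_ge_zero) auto
  moreover have "0 < sin x" "0 < sin y" using assms by (auto intro!: sin_gt_zero)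
  ultimately show ?thesis by (simp add: cot_def sin_diff field_simps)
qed

text \<open>The calibrating function \<open>\<Phi>\<close>, evaluated along the curve and its arc
  length, starts at 0 and does not increase. The shift \<open>e\<close> keeps the argument of
  \<open>cot\<close> away from its pole at arc length 0.\<close>

lemma horizontal_curve_bound:
  fixes \<gamma> :: "real \<Rightarrow> 'n::finite heis"
  assumes h: "horizontal_curve a b \<gamma>" and len: "curve_length a b \<gamma> \<le> ennreal l"
    and c: "0 < c" and e: "0 < e" and l: "0 \<le> l" "c * l + e < pi" and \<sigma>: "\<bar>\<sigma>\<bar> = 1"
  shows "\<sigma> * (snd (\<gamma> b) - snd (\<gamma> a) - 2 * im_form (fst (\<gamma> a)) (fst (\<gamma> b)))
    \<le> l / c - cot (c * l + e) * (norm (fst (\<gamma> b) - fst (\<gamma> a)))\<^sup>2"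
proof -
  define z where "z = fst (\<gamma> a)"
  define m where "m = (\<lambda>s. heis_norm (\<gamma> s) (vector_derivative \<gamma> (at s)))"
  define L where "L = (\<lambda>s. integral {a..s} m)"
  have ab: "a \<le> b" and ac: "abs_continuous_on {a..b} \<gamma>"
    and ae: "AE s in lebesgue. s \<in> {a..b} \<longrightarrow> (\<exists>v\<in>horizontal_space (\<gamma> s). (\<gamma> has_vector_derivative v) (at s))"
    using h by (auto simp: horizontal_curve_def)
  have fin: "curve_length a b \<gamma> < \<infinity>"
    using len by (rule le_less_trans) simp
  note m = horizontal_curve_speed_integrable[OF h fin, folded m_def]
  have m0: "0 \<le> m s" for s by (simp add: m_def heis_norm_nonneg)
  have Lmono: "L u \<le> L v" if "a \<le> u" "u \<le> v" "v \<le> b" for u v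
    unfolding L_def using m(1) m0 that
    by (intro integral_subset_le integrable_subinterval_real[OF m(1)]) auto
  have Lb: "L b \<le> l" using len m(2) l by (simp add: L_def)
  have La: "L a = 0" by (simp add: L_def)
  have L0: "0 \<le> L s" "L s \<le> l" if "s \<in> {a..b}" for s
    using Lmono[of a s] Lmono[of s b] that Lb La by auto
  \<comment> \<open>A positive lower bound for the sine over all arguments of \<open>cot\<close>
    that occur. It bounds \<open>C\<close> and its derivative and hence the Lipschitz constant of
    \<open>\<Phi>\<close> along the curve.\<close>
  define t where "t = min (sin e) (sin (c * l + e))"
  have cl: "0 \<le> c * l" using c l by simp
  have "0 < t" using e l cl by (auto simp: t_def intro!: sin_gt_zero)
  have rng: "e \<le> c * x + e \<and> c * x + e \<le> c * l + e" if "0 \<le> x" "x \<le> l" for x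
    using that c by simp
  have st: "t \<le> sin (c * x + e)" if "0 \<le> x" "x \<le> l" for x
    unfolding t_def using rng[OF that] e l by (intro sin_ge_min) auto
  obtain M where M: "0 < M" "\<And>s. s \<in> {a..b} \<Longrightarrow> norm (fst (\<gamma> s) - z) \<le> M"
  proof -
    have "compact ((\<lambda>s. fst (\<gamma> s) - z) ` {a..b})"
      by (intro compact_continuous_image continuous_intros abs_continuous_on_imp_continuous_on[OF ac]) simp
    then have "bounded ((\<lambda>s. fst (\<gamma> s) - z) ` {a..b})" by (rule compact_imp_bounded)
    then show thesis using that unfolding bounded_pos by auto
  qed
  define C where "C = (\<lambda>x. cot (c * x + e))"
  define C' where "C' = (\<lambda>x. - c / (sin (c * x + e))\<^sup>2)"
  have dC: "(C has_real_derivative C' x) (at x)" if "0 \<le> x" "x \<le> l" for x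
    unfolding C_def C'_def using st[OF that] \<open>0 < t\<close> by (intro cot_has_derivative) auto
  have C'b: "\<bar>C' x\<bar> \<le> c / t\<^sup>2" if "0 \<le> x" "x \<le> l" for x
  proof -
    have "t\<^sup>2 \<le> (sin (c * x + e))\<^sup>2" using st[OF that] \<open>0 < t\<close> by (intro power_mono) auto
    moreover have "0 < t\<^sup>2" using \<open>0 < t\<close> by simp
    ultimately have "c / (sin (c * x + e))\<^sup>2 \<le> c / t\<^sup>2"
      using c by (intro divide_left_mono mult_pos_pos) auto
    then show ?thesis unfolding C'_def using c by simp
  qed
  have Cb: "\<bar>C x\<bar> \<le> 1 / t" if "0 \<le> x" "x \<le> l" for x
    unfolding C_def cot_def abs_divide
    using st[OF that] \<open>0 < t\<close> by (intro frac_le) auto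
  have Clip: "\<bar>C x - C y\<bar> \<le> c / t\<^sup>2 * \<bar>x - y\<bar>" if "0 \<le> x" "x \<le> l" "0 \<le> y" "y \<le> l" for x y
  proof -
    have "norm (C x - C y) \<le> c / t\<^sup>2 * norm (x - y)"
      by (rule field_differentiable_bound[of "{0..l}" C C'])
        (use that dC C'b in \<open>auto intro: has_field_derivative_at_within\<close>)
    then show ?thesis by simp
  qed
  define \<Phi> where "\<Phi> = (\<lambda>y :: 'n heis \<times> real. \<sigma> * (snd (fst y) - snd (\<gamma> a) - 2 * im_form z (fst (fst y)))
      + C (snd y) * ((fst (fst y) - z) \<bullet> (fst (fst y) - z)) - snd y / c)"
  define \<Phi>' where "\<Phi>' = (\<lambda>s (y :: 'n heis \<times> real). \<sigma> * (snd (fst y) - 2 * im_form z (fst (fst y)))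
      + (C (L s) * (2 * ((fst (\<gamma> s) - z) \<bullet> fst (fst y))) + C' (L s) * snd y * ((fst (\<gamma> s) - z) \<bullet> (fst (\<gamma> s) - z))) - snd y / c)"
  \<comment> \<open>The three groups bound the variation of the three terms of
    \<open>\<Phi>\<close>: the vertical one, the product of \<open>cot\<close> with the squared
    displacement, and the arc length divided by \<open>c\<close>.\<close>
  define k where "k = (1 + 2 * norm z) + (1 / t * (2 * M) + M\<^sup>2 * (c / t\<^sup>2)) + 1 / c"
  obtain N where N: "N \<in> null_sets lebesgue" "\<And>s. s \<in> {a..b} \<Longrightarrow> s \<notin> N \<Longrightarrow>
      \<exists>v\<in>horizontal_space (\<gamma> s). (\<gamma> has_vector_derivative v) (at s)"
    using ae unfolding completion.AE_iff_null_sets by auto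
  have "\<Phi> (\<gamma> b, L b) \<le> \<Phi> (\<gamma> a, L a)"
  proof (rule abs_continuous_calibration[OF ab ac m(1) m0, of L \<Phi> \<Phi>' k])
    show "L s = integral {a..s} m" for s by (simp add: L_def)
    show "(\<Phi> has_derivative \<Phi>' s) (at (\<gamma> s, L s))" if "s \<in> {a..b}" for s
    proof -
      have "((\<lambda>y :: 'n heis \<times> real. im_form z (fst (fst y))) has_derivative (\<lambda>y. im_form z (fst (fst y)))) (at (\<gamma> s, L s))"
        by (rule bounded_linear.has_derivative[OF bounded_linear_im_form]) (auto intro!: derivative_eq_intros)
      moreover have "((\<lambda>y :: 'n heis \<times> real. C (snd y)) has_derivative (\<lambda>y. C' (L s) * snd y)) (at (\<gamma> s, L s))"
        by (rule has_derivative_compose[where f = snd and g = C and s = UNIV, unfolded has_field_derivative_def[symmetric]])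
          (use dC[OF L0[OF that]] in \<open>auto intro!: derivative_eq_intros simp: has_field_derivative_def\<close>)
      ultimately show ?thesis
        unfolding \<Phi>_def \<Phi>'_def
        by (auto intro!: derivative_eq_intros simp: inner_commute fun_eq_iff algebra_simps divide_inverse)
    qed
    show "\<bar>\<Phi> (\<gamma> v, L v) - \<Phi> (\<gamma> u, L u)\<bar> \<le> k * (norm (\<gamma> v - \<gamma> u) + \<bar>L v - L u\<bar>)"
      if uv: "u \<in> {a..b}" "v \<in> {a..b}" for u v
    proof -
      define d where "d = norm (\<gamma> v - \<gamma> u)"
      have "0 \<le> d" by (simp add: d_def)
      have d1: "norm (fst (\<gamma> v) - fst (\<gamma> u)) \<le> d" "\<bar>snd (\<gamma> v) - snd (\<gamma> u)\<bar> \<le> d"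
        unfolding d_def by (metis fst_diff norm_fst_le prod.collapse)
          (metis snd_diff norm_snd_le prod.collapse real_norm_def)
      define w where "w = (\<lambda>s. fst (\<gamma> s) - z)"
      have dw: "norm (w v - w u) \<le> d" using d1 by (simp add: w_def)
      have wb: "norm (w v) \<le> M" "norm (w u) \<le> M" using M uv by (auto simp: w_def)
      have im: "\<bar>im_form z (fst (\<gamma> v)) - im_form z (fst (\<gamma> u))\<bar> \<le> norm z * d"
      proof -
        have "\<bar>im_form z (fst (\<gamma> v)) - im_form z (fst (\<gamma> u))\<bar> \<le> norm z * norm (fst (\<gamma> v) - fst (\<gamma> u))"
          using im_form_le[of z "fst (\<gamma> v) - fst (\<gamma> u)"] by (simp add: im_form_diff_right)
        also have "\<dots> \<le> norm z * d" using d1 by (intro mult_left_mono) auto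
        finally show ?thesis .
      qed
      have "\<bar>\<sigma> * ((snd (\<gamma> v) - snd (\<gamma> u)) - 2 * (im_form z (fst (\<gamma> v)) - im_form z (fst (\<gamma> u))))\<bar> \<le> (1 + 2 * norm z) * d"
      proof -
        have *: "\<bar>y - 2 * x\<bar> \<le> d + 2 * r" if "\<bar>y\<bar> \<le> d" "\<bar>x\<bar> \<le> r" for x y r :: real
          using that by linarith
        show ?thesis
          unfolding abs_mult \<sigma> using *[OF d1(2) im] by (simp add: distrib_right mult.assoc)
      qed
      moreover have "\<bar>C (L v) * (w v \<bullet> w v) - C (L u) * (w u \<bullet> w u)\<bar> \<le> 1 / t * (2 * M) * d + M\<^sup>2 * (c / t\<^sup>2) * \<bar>L v - L u\<bar>"
      proof -
        have "C (L v) * (w v \<bullet> w v) - C (L u) * (w u \<bullet> w u)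
            = C (L v) * ((w v + w u) \<bullet> (w v - w u)) + (C (L v) - C (L u)) * (w u \<bullet> w u)"
          by (simp add: algebra_simps inner_commute)
        also have "\<bar>\<dots>\<bar> \<le> \<bar>C (L v)\<bar> * \<bar>(w v + w u) \<bullet> (w v - w u)\<bar> + \<bar>C (L v) - C (L u)\<bar> * \<bar>w u \<bullet> w u\<bar>"
          by (metis abs_mult abs_triangle_ineq)
        also have "\<dots> \<le> 1 / t * ((2 * M) * d) + (c / t\<^sup>2 * \<bar>L v - L u\<bar>) * M\<^sup>2"
        proof (intro add_mono mult_mono)
          show "\<bar>C (L v)\<bar> \<le> 1 / t" using Cb L0 uv by blast
          have "\<bar>(w v + w u) \<bullet> (w v - w u)\<bar> \<le> norm (w v + w u) * norm (w v - w u)"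
            by (rule Cauchy_Schwarz_ineq2)
          also have "\<dots> \<le> (2 * M) * d"
            using wb dw norm_triangle_ineq[of "w v" "w u"] \<open>0 < M\<close> by (intro mult_mono) auto
          finally show "\<bar>(w v + w u) \<bullet> (w v - w u)\<bar> \<le> (2 * M) * d" .
          show "\<bar>C (L v) - C (L u)\<bar> \<le> c / t\<^sup>2 * \<bar>L v - L u\<bar>" using Clip L0 uv by blast
          show "\<bar>w u \<bullet> w u\<bar> \<le> M\<^sup>2"
            using wb by (simp add: dot_square_norm power_mono)
        qed (use \<open>0 < t\<close> c \<open>0 < M\<close> in auto)
        finally show ?thesis by (simp add: mult.commute mult.left_commute)
      qed
      moreover have "\<bar>L v / c - L u / c\<bar> = 1 / c * \<bar>L v - L u\<bar>"
        using c by (simp add: abs_divide flip: diff_divide_distrib)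
      ultimately have "\<bar>\<Phi> (\<gamma> v, L v) - \<Phi> (\<gamma> u, L u)\<bar>
          \<le> (1 + 2 * norm z) * d + (1 / t * (2 * M) * d + M\<^sup>2 * (c / t\<^sup>2) * \<bar>L v - L u\<bar>) + 1 / c * \<bar>L v - L u\<bar>"
        by (simp add: \<Phi>_def w_def algebra_simps)
      also have "\<dots> \<le> k * d + k * \<bar>L v - L u\<bar>"
      proof -
        have "(1 + 2 * norm z) + 1 / t * (2 * M) \<le> k" "M\<^sup>2 * (c / t\<^sup>2) + 1 / c \<le> k"
          using \<open>0 < t\<close> c \<open>0 < M\<close> by (auto simp: k_def)
        then have "((1 + 2 * norm z) + 1 / t * (2 * M)) * d \<le> k * d"
          "(M\<^sup>2 * (c / t\<^sup>2) + 1 / c) * \<bar>L v - L u\<bar> \<le> k * \<bar>L v - L u\<bar>"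
          using \<open>0 \<le> d\<close> by (auto intro: mult_right_mono)
        then show ?thesis unfolding distrib_right by linarith
      qed
      finally show ?thesis by (simp add: d_def distrib_left)
    qed
    show "\<bar>\<Phi>' s (0, 1)\<bar> \<le> k" if s: "s \<in> {a..b}" for s
    proof -
      have "im_form z 0 = 0" by (simp add: im_form_def)
      then have "\<Phi>' s (0, 1) = C' (L s) * ((fst (\<gamma> s) - z) \<bullet> (fst (\<gamma> s) - z)) - 1 / c"
        by (simp add: \<Phi>'_def)
      also have "\<bar>\<dots>\<bar> \<le> \<bar>C' (L s)\<bar> * \<bar>(fst (\<gamma> s) - z) \<bullet> (fst (\<gamma> s) - z)\<bar> + 1 / c"
        using abs_triangle_ineq4[of "C' (L s) * ((fst (\<gamma> s) - z) \<bullet> (fst (\<gamma> s) - z))" "1 / c"] c by (simp add: abs_mult)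
      also have "\<bar>C' (L s)\<bar> * \<bar>(fst (\<gamma> s) - z) \<bullet> (fst (\<gamma> s) - z)\<bar> \<le> c / t\<^sup>2 * M\<^sup>2"
        using C'b[OF L0[OF s]] M(2)[OF s] c \<open>0 < t\<close>
        by (intro mult_mono) (auto simp: dot_square_norm power_mono)
      also have "c / t\<^sup>2 * M\<^sup>2 + 1 / c \<le> k"
        using \<open>0 < t\<close> c \<open>0 < M\<close> by (auto simp: k_def mult.commute[of c])
      finally show ?thesis by simp
    qed
    show "negligible N" using N(1) by (simp add: negligible_iff_null_sets)
    show "\<exists>v. (\<gamma> has_vector_derivative v) (at s within {a..b}) \<and> \<Phi>' s (v, m s) \<le> 0"
      if s: "s \<in> {a..b} - N" for s
    proof -
      obtain v where v: "v \<in> horizontal_space (\<gamma> s)" "(\<gamma> has_vector_derivative v) (at s)"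
        using N(2) s by blast
      have ms: "m s = norm (fst v)"
        using v by (simp add: m_def vector_derivative_at heis_norm_horizontal)
      have sv: "snd v = 2 * im_form (fst (\<gamma> s)) (fst v)"
        using T_coeff_horizontal[OF v(1)] by (simp add: T_coeff_def)
      have "0 < sin (c * L s + e)" using st[OF L0, of s] s \<open>0 < t\<close> by simp
      from calibration_slope[OF c this \<sigma>, of "fst (\<gamma> s) - z" "fst v"]
      have "\<Phi>' s (v, m s) \<le> 0"
        by (simp add: \<Phi>'_def C_def C'_def ms sv im_form_diff_left dot_square_norm algebra_simps)
      moreover have "(\<gamma> has_vector_derivative v) (at s within {a..b})"
        using v(2) by (rule has_vector_derivative_at_within)
      ultimately show ?thesis by blast
    qed
  qed
  then have "\<sigma> * (snd (\<gamma> b) - snd (\<gamma> a) - 2 * im_form z (fst (\<gamma> b))) \<le> L b / c - C (L b) * (norm (fst (\<gamma> b) - z))\<^sup>2"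
    by (simp add: \<Phi>_def La z_def dot_square_norm)
  \<comment> \<open>The curve may be shorter than \<open>l\<close>; both terms of the bound can only
    grow when \<open>L b\<close> is replaced by \<open>l\<close>.\<close>
  moreover have "L b / c \<le> l / c" using Lb c by (simp add: divide_right_mono)
  moreover have "cot (c * l + e) * (norm (fst (\<gamma> b) - z))\<^sup>2 \<le> C (L b) * (norm (fst (\<gamma> b) - z))\<^sup>2"
    unfolding C_def using rng[of "L b"] L0[of b] ab e l by (intro mult_right_mono cot_antimono) auto
  ultimately show ?thesis by (simp add: z_def)
qed

text \<open>The vertical coordinate of \<open>p\<^sup>-\<^sup>1 q\<close>.\<close>

definition T_offset :: "'n::finite heis \<Rightarrow> 'n heis \<Rightarrow> real" where
  "T_offset p q = snd q - snd p - 2 * im_form (fst p) (fst q)"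

lemma cc_dist_leD:
  assumes d: "cc_dist p q \<le> ennreal l" and l: "0 \<le> l" and \<phi>: "0 < \<phi>" "\<phi> < pi"
  shows "\<bar>T_offset p q\<bar> \<le> l\<^sup>2 / \<phi> - cot \<phi> * (norm (fst q - fst p))\<^sup>2"
proof -
  have "\<sigma> * T_offset p q \<le> l\<^sup>2 / \<phi> - cot \<phi> * (norm (fst q - fst p))\<^sup>2" if \<sigma>: "\<bar>\<sigma>\<bar> = 1" for \<sigma>
  proof -
    have *: "\<sigma> * T_offset p q \<le> (l + \<delta>)\<^sup>2 / (\<phi> - \<delta>) - cot \<phi> * (norm (fst q - fst p))\<^sup>2" if \<delta>: "0 < \<delta>" "\<delta> < \<phi>" for \<delta>
    proof -
      \<comment> \<open>The infimum yields a curve only for a length strictly above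
        \<open>l\<close>; the slack \<open>\<delta>\<close> also makes the divisor
        \<open>l + \<delta>\<close> positive when \<open>l = 0\<close>.\<close>
      have "cc_dist p q < ennreal (l + \<delta>)"
        using d by (rule le_less_trans) (use l \<delta> in \<open>simp add: ennreal_less_iff\<close>)
      then obtain a b \<gamma> where \<gamma>: "horizontal_curve a b \<gamma>" "\<gamma> a = p" "\<gamma> b = q" and "curve_length a b \<gamma> < ennreal (l + \<delta>)"
        unfolding cc_dist_def Inf_less_iff by blast
      then have "curve_length a b \<gamma> \<le> ennreal (l + \<delta>)" by simp
      \<comment> \<open>This value of \<open>c\<close> makes the final argument
        \<open>c * (l + \<delta>) + \<delta>\<close> of \<open>cot\<close> equal to
        \<open>\<phi>\<close>.\<close>
      from horizontal_curve_bound[OF \<gamma>(1) this, of "(\<phi> - \<delta>) / (l + \<delta>)" \<delta> \<sigma>]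
      show ?thesis using l \<delta> \<phi> \<sigma> by (simp add: \<gamma> T_offset_def power2_eq_square)
    qed
    have "((\<lambda>\<delta>. (l + \<delta>)\<^sup>2 / (\<phi> - \<delta>) - cot \<phi> * (norm (fst q - fst p))\<^sup>2) \<longlongrightarrow>
        (l + 0)\<^sup>2 / (\<phi> - 0) - cot \<phi> * (norm (fst q - fst p))\<^sup>2) (at_right 0)"
      using \<phi> by (intro tendsto_intros) auto
    moreover have "\<forall>\<^sub>F \<delta> in at_right 0. \<sigma> * T_offset p q \<le> (l + \<delta>)\<^sup>2 / (\<phi> - \<delta>) - cot \<phi> * (norm (fst q - fst p))\<^sup>2"
      unfolding eventually_at_right_field using * \<phi> by blast
    ultimately have "\<sigma> * T_offset p q \<le> (l + 0)\<^sup>2 / (\<phi> - 0) - cot \<phi> * (norm (fst q - fst p))\<^sup>2"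
      by (rule tendsto_lowerbound) simp
    then show ?thesis by simp
  qed
  from this[of 1] this[of "-1"] show ?thesis by simp
qed

lemma cos_le_mult_cot:
  assumes "0 < \<phi>" "\<phi> \<le> pi / 2"
  shows "cos \<phi> \<le> \<phi> * cot \<phi>"
proof -
  have "sin \<phi> * cos \<phi> \<le> \<phi> * cos \<phi>"
    using assms sin_x_le_x[of \<phi>] by (intro mult_right_mono cos_ge_zero) auto
  moreover have "0 < sin \<phi>" using assms by (intro sin_gt_zero) auto
  ultimately show ?thesis by (simp add: cot_def field_simps)
qed

text \<open>Multiply by \<open>\<phi>\<close> and let it tend to 0:
  \<open>\<phi> * cot \<phi>\<close> is at least \<open>cos \<phi>\<close>, which tends to
  1.\<close>

lemma dual_bound_imp_norm_le:
  fixes D l :: real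
  assumes l: "0 \<le> l" and b: "\<And>\<phi>. 0 < \<phi> \<Longrightarrow> \<phi> < pi / 2 \<Longrightarrow> 0 \<le> l\<^sup>2 / \<phi> - cot \<phi> * D\<^sup>2"
  shows "D \<le> l"
proof -
  have "cos \<phi> * D\<^sup>2 \<le> l\<^sup>2" if "0 < \<phi>" "\<phi> < pi / 2" for \<phi>
  proof -
    have "cos \<phi> * D\<^sup>2 \<le> \<phi> * cot \<phi> * D\<^sup>2"
      using that cos_le_mult_cot[of \<phi>] by (intro mult_right_mono) auto
    also have "\<dots> \<le> l\<^sup>2" using b[OF that] that by (simp add: field_simps)
    finally show ?thesis .
  qed
  then have "\<forall>\<^sub>F \<phi> in at_right 0. cos \<phi> * D\<^sup>2 \<le> l\<^sup>2"
    unfolding eventually_at_right_field using pi_half_gt_zero by blast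
  moreover have "((\<lambda>\<phi>. cos \<phi> * D\<^sup>2) \<longlongrightarrow> cos 0 * D\<^sup>2) (at_right 0)"
    by (intro tendsto_intros)
  ultimately have "cos 0 * D\<^sup>2 \<le> l\<^sup>2"
    by (intro tendsto_upperbound[of "\<lambda>\<phi>. cos \<phi> * D\<^sup>2" _ "at_right 0"]) auto
  then have "D\<^sup>2 \<le> l\<^sup>2" by simp
  then show ?thesis using l by (rule power2_le_imp_le)
qed

lemma cc_dist_leD_norm:
  assumes d: "cc_dist p q \<le> ennreal l" and l: "0 \<le> l"
  shows "norm (fst q - fst p) \<le> l"
proof (rule dual_bound_imp_norm_le[OF l])
  fix \<phi> :: real assume "0 < \<phi>" "\<phi> < pi / 2"
  then show "0 \<le> l\<^sup>2 / \<phi> - cot \<phi> * (norm (fst q - fst p))\<^sup>2"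
    using cc_dist_leD[OF d l, of \<phi>] by simp
qed

section \<open>Upper bounds for the distance, by explicit curves of constant speed\<close>

lemma cc_dist_le_speed:
  fixes \<gamma> :: "real \<Rightarrow> 'n::finite heis"
  assumes der: "\<And>s. (\<gamma> has_vector_derivative \<gamma>' s) (at s)"
    and cont: "continuous_on {0..1} \<gamma>'"
    and hor: "\<And>s. \<gamma>' s \<in> horizontal_space (\<gamma> s)"
    and k: "\<And>s. norm (fst (\<gamma>' s)) = k"
  shows "cc_dist (\<gamma> 0) (\<gamma> 1) \<le> ennreal k"
proof -
  obtain B where B: "0 < B" "\<And>s. s \<in> {0..1} \<Longrightarrow> norm (\<gamma>' s) \<le> B"
    using compact_imp_bounded[OF compact_continuous_image[OF cont compact_Icc]] unfolding bounded_pos by auto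
  have lip: "norm (\<gamma> v - \<gamma> u) \<le> B * (v - u)" if "0 \<le> u" "u \<le> v" "v \<le> 1" for u v
  proof -
    have "norm (\<gamma> v - \<gamma> u) \<le> B * norm (v - u)"
    proof (rule differentiable_bound[of "{0..1}" \<gamma> "\<lambda>s x. x *\<^sub>R \<gamma>' s"])
      show "(\<gamma> has_derivative (\<lambda>x. x *\<^sub>R \<gamma>' s)) (at s within {0..1})" for s
        using der has_vector_derivative_at_within has_vector_derivative_def by blast
      show "onorm (\<lambda>x. x *\<^sub>R \<gamma>' s) \<le> B" if "s \<in> {0..1}" for s
        using B(2)[OF that] by (intro onorm_le) (simp add: mult.commute[of B] mult_left_mono)
    qed (use that in auto)
    then show ?thesis using that by simp
  qed
  have "abs_continuous_on {0..1} \<gamma>"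
    unfolding abs_continuous_on_def
  proof (intro allI impI)
    fix e :: real assume "0 < e"
    show "\<exists>d>0. \<forall>D. D division_of \<Union>D \<and> \<Union>D \<subseteq> {0..1} \<and> (\<Sum>K\<in>D. Sup K - Inf K) < d \<longrightarrow>
        (\<Sum>K\<in>D. norm (\<gamma> (Sup K) - \<gamma> (Inf K))) < e"
    proof (intro exI[of _ "e / B"] conjI allI impI)
      show "0 < e / B" using B \<open>0 < e\<close> by simp
      fix D :: "real set set" assume D: "D division_of \<Union>D \<and> \<Union>D \<subseteq> {0..1} \<and> (\<Sum>K\<in>D. Sup K - Inf K) < e / B"
      have "(\<Sum>K\<in>D. norm (\<gamma> (Sup K) - \<gamma> (Inf K))) \<le> (\<Sum>K\<in>D. B * (Sup K - Inf K))"
      proof (rule sum_mono)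
        fix K assume "K \<in> D"
        then obtain u v where "K = {u..v}" "K \<noteq> {}" "K \<subseteq> {0..1}"
          using D division_ofD(2,3,4)[of D "\<Union>D" K] by (metis box_real(2) subset_trans)
        then show "norm (\<gamma> (Sup K) - \<gamma> (Inf K)) \<le> B * (Sup K - Inf K)"
          using lip[of u v] by auto
      qed
      also have "\<dots> = B * (\<Sum>K\<in>D. Sup K - Inf K)" by (simp add: sum_distrib_left)
      also have "\<dots> < B * (e / B)" using D B by (intro mult_strict_left_mono) auto
      finally show "(\<Sum>K\<in>D. norm (\<gamma> (Sup K) - \<gamma> (Inf K))) < e" using B by simp
    qed
  qed
  then have h: "horizontal_curve 0 1 \<gamma>"
    unfolding horizontal_curve_def using der hor by (auto intro!: AE_I2)
  have "curve_length 0 1 \<gamma> = (\<integral>\<^sup>+s\<in>{0..1::real}. ennreal k \<partial>lebesgue)"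
    unfolding curve_length_def
    by (intro nn_integral_cong) (simp add: vector_derivative_at[OF der] heis_norm_horizontal[OF hor] k)
  also have "\<dots> = ennreal k"
    by (simp add: nn_integral_cmult_indicator)
  finally have "curve_length 0 1 \<gamma> = ennreal k" .
  moreover have "cc_dist (\<gamma> 0) (\<gamma> 1) \<le> curve_length 0 1 \<gamma>"
    unfolding cc_dist_def using h by (intro Inf_lower) blast
  ultimately show ?thesis by simp
qed

text \<open>A planar curve determines its horizontal lift: the height has derivative
  \<open>2 * im_form (w s) (w' s)\<close>. Left translation by \<open>p\<close> preserves
  horizontality and planar speed.\<close>

lemma cc_dist_translate_le_speed:
  fixes w w' :: "real \<Rightarrow> complex ^ 'n::finite" and \<tau> :: "real \<Rightarrow> real"
  assumes w: "\<And>s. (w has_vector_derivative w' s) (at s)" and cw: "continuous_on {0..1} w'"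
    and \<tau>: "\<And>s. (\<tau> has_real_derivative 2 * im_form (w s) (w' s)) (at s)"
    and k: "\<And>s. norm (w' s) = k"
  shows "cc_dist (heis_mult p (w 0, \<tau> 0)) (heis_mult p (w 1, \<tau> 1)) \<le> ennreal k"
proof (rule cc_dist_le_speed)
  define \<gamma>' where "\<gamma>' = (\<lambda>s. (w' s, 2 * im_form (w s) (w' s) + 2 * im_form (fst p) (w' s)))"
  show "((\<lambda>s. heis_mult p (w s, \<tau> s)) has_vector_derivative \<gamma>' s) (at s)" for s
  proof -
    have "((\<lambda>s. im_form (fst p) (w s)) has_vector_derivative im_form (fst p) (w' s)) (at s)"
      by (rule bounded_linear.has_vector_derivative[OF bounded_linear_im_form w])
    moreover have "(\<tau> has_vector_derivative 2 * im_form (w s) (w' s)) (at s)"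
      using \<tau> by (simp add: has_real_derivative_iff_has_vector_derivative)
    ultimately show ?thesis
      unfolding heis_mult_def \<gamma>'_def fst_conv snd_conv
      by (auto intro!: derivative_eq_intros w simp: has_real_derivative_iff_has_vector_derivative)
  qed
  have cw0: "continuous_on {0..1} w"
    by (meson continuous_at_imp_continuous_on has_vector_derivative_continuous w)
  show "continuous_on {0..1} \<gamma>'"
    unfolding \<gamma>'_def im_form_def by (intro continuous_intros cw cw0)
  show "\<gamma>' s \<in> horizontal_space (heis_mult p (w s, \<tau> s))" for s
    by (rule horizontal_spaceI)
      (simp add: \<gamma>'_def heis_mult_def im_form_def algebra_simps sum.distrib sum_distrib_left sum_subtractf)
  show "norm (fst (\<gamma>' s)) = k" for s by (simp add: \<gamma>'_def k)
qed

lemma heis_mult_zero [simp]: "heis_mult p (0, 0) = p"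
  by (simp add: heis_mult_def im_form_def prod_eq_iff)

lemma cc_dist_line_le: "cc_dist p (heis_mult p (v, 0)) \<le> ennreal (norm v)"
proof -
  have im: "im_form (s *\<^sub>R v) v = 0" for s
    by (simp add: im_form_def)
  have "cc_dist (heis_mult p (0 *\<^sub>R v, 0)) (heis_mult p (1 *\<^sub>R v, 0)) \<le> ennreal (norm v)"
    by (rule cc_dist_translate_le_speed[where w = "\<lambda>s. s *\<^sub>R v" and w' = "\<lambda>s. v" and \<tau> = "\<lambda>s. 0"])
      (auto intro!: derivative_eq_intros simp: im)
  then show ?thesis by simp
qed

text \<open>The planar curve runs from 0 along the circle of centre \<open>- a\<close> and radius
  \<open>norm a\<close>, turning by the angle \<open>\<kappa>\<close>. The height reached is -4
  times the signed area of the circular segment.\<close>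

lemma cc_dist_arc_le:
  fixes a :: "complex ^ 'n::finite"
  shows "cc_dist p (heis_mult p ((\<chi> j. (cis \<kappa> - 1) * a $ j), - 2 * (norm a)\<^sup>2 * (\<kappa> - sin \<kappa>))) \<le> ennreal (\<bar>\<kappa>\<bar> * norm a)"
proof -
  have bl: "bounded_linear (\<lambda>c. \<chi> j. c * a $ j)"
    unfolding linear_conv_bounded_linear[symmetric]
    by (rule linearI) (simp_all add: vec_eq_iff algebra_simps)
  define w where "w = (\<lambda>s. \<chi> j. (cis (\<kappa> * s) - 1) * a $ j)"
  define w' where "w' = (\<lambda>s. \<chi> j. (\<i> * \<kappa> * cis (\<kappa> * s)) * a $ j)"
  define \<tau> where "\<tau> = (\<lambda>s. - 2 * (norm a)\<^sup>2 * (\<kappa> * s - sin (\<kappa> * s)))"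
  have "cc_dist (heis_mult p (w 0, \<tau> 0)) (heis_mult p (w 1, \<tau> 1)) \<le> ennreal (\<bar>\<kappa>\<bar> * norm a)"
  proof (rule cc_dist_translate_le_speed)
    show "(w has_vector_derivative w' s) (at s)" for s
    proof -
      have "((\<lambda>s. exp (s *\<^sub>R (\<i> * \<kappa>))) has_vector_derivative exp (s *\<^sub>R (\<i> * \<kappa>)) * (\<i> * \<kappa>)) (at s)"
        by (rule exp_scaleR_has_vector_derivative_right)
      moreover have "exp (s *\<^sub>R (\<i> * \<kappa>)) = cis (\<kappa> * s)" for s
        by (simp add: cis_conv_exp scaleR_conv_of_real algebra_simps)
      ultimately have "((\<lambda>s. cis (\<kappa> * s) - 1) has_vector_derivative \<i> * \<kappa> * cis (\<kappa> * s)) (at s)"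
        by (auto intro!: derivative_eq_intros simp: mult.commute)
      then show ?thesis
        unfolding w_def w'_def by (rule bounded_linear.has_vector_derivative[OF bl])
    qed
    have "continuous_on {0..1} (\<lambda>s. \<i> * complex_of_real \<kappa> * cis (\<kappa> * s))"
      by (intro continuous_intros)
    then show "continuous_on {0..1} w'"
      unfolding w'_def by (rule bounded_linear.continuous_on[OF bl])
    show "norm (w' s) = \<bar>\<kappa>\<bar> * norm a" for s
      unfolding w'_def norm_cmult_vec by (simp add: norm_mult)
    show "(\<tau> has_real_derivative 2 * im_form (w s) (w' s)) (at s)" for s
    proof -
      have "im_form (w s) (w' s) = (\<Sum>j\<in>UNIV. - \<kappa> * (1 - cos (\<kappa> * s)) * (cmod (a $ j))\<^sup>2)"
        unfolding im_form_def
      proof (rule sum.cong[OF refl])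
        fix j
        have "w s $ j * cnj (w' s $ j) = (cis (\<kappa> * s) - 1) * (- \<i> * \<kappa> * cis (- (\<kappa> * s))) * (a $ j * cnj (a $ j))"
          by (simp add: w_def w'_def cis_cnj algebra_simps)
        also have "(cis (\<kappa> * s) - 1) * (- \<i> * \<kappa> * cis (- (\<kappa> * s))) = - \<i> * \<kappa> * (1 - cis (- (\<kappa> * s)))"
          by (simp add: algebra_simps cis_mult)
        also have "a $ j * cnj (a $ j) = of_real ((cmod (a $ j))\<^sup>2)"
          by (rule complex_norm_square[symmetric])
        finally show "Im (w s $ j * cnj (w' s $ j)) = - \<kappa> * (1 - cos (\<kappa> * s)) * (cmod (a $ j))\<^sup>2"
          by (simp del: of_real_power)
      qed
      also have "\<dots> = - \<kappa> * (1 - cos (\<kappa> * s)) * (norm a)\<^sup>2"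
        by (simp add: norm_vec_def L2_set_def sum_nonneg sum_distrib_left)
      finally show ?thesis
        unfolding \<tau>_def by (auto intro!: derivative_eq_intros simp: algebra_simps)
    qed
  qed
  moreover have "w 0 = 0" "\<tau> 0 = 0" "w 1 = (\<chi> j. (cis \<kappa> - 1) * a $ j)" "\<tau> 1 = - 2 * (norm a)\<^sup>2 * (\<kappa> - sin \<kappa>)"
    by (auto simp: w_def \<tau>_def vec_eq_iff)
  ultimately show ?thesis by simp
qed

text \<open>\<open>\<phi>\<close> is half the opening angle of an arc, and \<open>y\<close> is the
  ratio of the height to the squared chord. Multiplied by the square of \<open>sin \<phi>\<close>,
  the equation becomes \<open>G \<phi> = 0\<close>, which the intermediate value theorem
  solves.\<close>

lemma arc_angle_exists:
  fixes y :: real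
  assumes y: "0 < y"
  obtains \<phi> where "0 < \<phi>" "\<phi> < pi" "\<phi> / (sin \<phi>)\<^sup>2 - cot \<phi> = y"
proof -
  define G where "G = (\<lambda>\<phi>. \<phi> - sin \<phi> * cos \<phi> - y * (sin \<phi>)\<^sup>2)"
  \<comment> \<open>\<open>G\<close> vanishes at 0 as well. It decreases as long as
    \<open>tan x < y\<close>, so at \<open>arctan y\<close> it is already negative, and starting
    there excludes the trivial root.\<close>
  define b where "b = arctan y"
  have b: "0 < b" "b < pi / 2" using y arctan_ubound by (auto simp: b_def)
  have "G b < G 0"
  proof (rule DERIV_neg_imp_decreasing_open[OF b(1)])
    fix x assume x: "0 < x" "x < b"
    have d: "(G has_real_derivative 2 * sin x * (sin x - y * cos x)) (at x)"
      unfolding G_def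
      by (auto intro!: derivative_eq_intros)
        (use sin_cos_squared_add[of x] in \<open>simp add: power2_eq_square algebra_simps\<close>)
    have "0 < sin x" "0 < cos x" using x b by (auto intro!: sin_gt_zero cos_gt_zero)
    moreover have "tan x < y"
      using x b tan_monotone[of x b] by (simp add: b_def tan_arctan)
    ultimately have "sin x < y * cos x" by (simp add: tan_def field_simps)
    then have "2 * sin x * (sin x - y * cos x) < 0"
      using \<open>0 < sin x\<close> by (simp add: mult_pos_neg)
    with d show "\<exists>l. (G has_real_derivative l) (at x) \<and> l < 0" by blast
  qed (auto intro!: continuous_intros simp: G_def)
  then have "G b \<le> 0" by (simp add: G_def)
  moreover have "0 \<le> G pi" by (simp add: G_def)
  moreover have "continuous_on {b..pi} G" unfolding G_def by (intro continuous_intros)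
  ultimately obtain \<phi> where \<phi>: "b \<le> \<phi>" "\<phi> \<le> pi" "G \<phi> = 0"
    using IVT'[of G b 0 pi] b by auto
  have "\<phi> \<noteq> pi" using \<phi>(3) by (auto simp: G_def)
  with \<phi> b have r: "0 < \<phi>" "\<phi> < pi" by auto
  then have s: "0 < sin \<phi>" by (rule sin_gt_zero)
  have "\<phi> / (sin \<phi>)\<^sup>2 - cot \<phi> = (\<phi> - sin \<phi> * cos \<phi>) / (sin \<phi>)\<^sup>2"
    using s by (simp add: cot_def power2_eq_square field_simps)
  also have "\<dots> = y" using \<phi>(3) s by (simp add: G_def)
  finally show thesis using that r by blast
qed

lemma heis_mult_offset: "heis_mult p (fst q - fst p, T_offset p q) = q"
  by (simp add: heis_mult_def T_offset_def im_form_diff_right prod_eq_iff)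

lemma norm_cis_diff_one: "cmod (cis (2 * x) - 1) = 2 * \<bar>sin x\<bar>"
proof -
  have "cis (2 * x) - 1 = cis x * (cis x - cis (- x))"
    by (simp add: algebra_simps cis_mult)
  moreover have "cis x - cis (- x) = 2 * \<i> * sin x"
    by (simp add: complex_eq_iff)
  ultimately have "cmod (cis (2 * x) - 1) = cmod (cis x) * cmod (2 * \<i> * sin x)"
    by (simp only: norm_mult)
  then show ?thesis by (simp add: norm_mult)
qed

text \<open>Join \<open>p\<close> to \<open>q\<close> by the lift of a segment if
  \<open>T = 0\<close>, of a full circle if \<open>w = 0\<close>, and of a circular arc otherwise.
  In the last case the hypothesis at the half-angle of that arc says exactly that the arc has length
  at most \<open>l\<close>.\<close>

lemma cc_dist_leI:
  fixes p q :: "'n::finite heis"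
  assumes l: "0 \<le> l"
    and b: "\<And>\<phi>. 0 < \<phi> \<Longrightarrow> \<phi> < pi \<Longrightarrow> \<bar>T_offset p q\<bar> \<le> l\<^sup>2 / \<phi> - cot \<phi> * (norm (fst q - fst p))\<^sup>2"
  shows "cc_dist p q \<le> ennreal l"
proof -
  define w where "w = fst q - fst p"
  define T where "T = T_offset p q"
  have q: "heis_mult p (w, T) = q" by (simp add: w_def T_def heis_mult_offset)
  note b = b[folded w_def T_def]
  show ?thesis
  proof (cases "T = 0")
    case True
    have "norm w \<le> l"
    proof (rule dual_bound_imp_norm_le[OF l])
      fix \<phi> :: real assume "0 < \<phi>" "\<phi> < pi / 2"
      then show "0 \<le> l\<^sup>2 / \<phi> - cot \<phi> * (norm w)\<^sup>2" using b[of \<phi>] by simp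
    qed
    have "cc_dist p q \<le> ennreal (norm w)"
      using cc_dist_line_le[of p w] q True by simp
    also have "\<dots> \<le> ennreal l" using \<open>norm w \<le> l\<close> by (rule ennreal_leI)
    finally show ?thesis .
  next
    case False
    \<comment> \<open>The sign of the height decides in which direction the arc is
      traversed.\<close>
    define \<sigma> where "\<sigma> = sgn T"
    have \<sigma>: "\<bar>\<sigma>\<bar> = 1" "\<sigma> * \<bar>T\<bar> = T" using False by (auto simp: \<sigma>_def sgn_if)
    have arc: "cc_dist p q \<le> ennreal l" if \<phi>: "0 \<le> \<phi>"
      and a: "(\<chi> j. (cis (- 2 * \<sigma> * \<phi>) - 1) * a $ j) = w"
      and T: "2 * (norm a)\<^sup>2 * (2 * \<phi> - sin (2 * \<phi>)) = \<bar>T\<bar>"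
      and len: "2 * \<phi> * norm a \<le> l" for \<phi> a
    proof -
      have "\<sigma> = 1 \<or> \<sigma> = -1" using \<sigma> by linarith
      then have "- 2 * (norm a)\<^sup>2 * (- 2 * \<sigma> * \<phi> - sin (- 2 * \<sigma> * \<phi>)) = \<sigma> * (2 * (norm a)\<^sup>2 * (2 * \<phi> - sin (2 * \<phi>)))"
        by (auto simp: algebra_simps)
      then have "cc_dist p (heis_mult p (w, T)) \<le> ennreal (\<bar>- 2 * \<sigma> * \<phi>\<bar> * norm a)"
        using cc_dist_arc_le[of p "- 2 * \<sigma> * \<phi>" a] a T \<sigma> by simp
      also have "\<bar>- 2 * \<sigma> * \<phi>\<bar> * norm a \<le> l" using len \<phi> \<sigma> by (simp add: abs_mult)
      finally show ?thesis using q by (simp add: ennreal_leI)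
    qed
    show ?thesis
    proof (cases "w = 0")
      case w: True
      \<comment> \<open>A full circle has half-angle \<open>pi\<close>, an excluded value in the
        hypothesis, so its bound is obtained as a limit.\<close>
      have "\<bar>T\<bar> \<le> l\<^sup>2 / pi"
      proof (rule tendsto_lowerbound)
        show "((\<lambda>\<phi>. l\<^sup>2 / \<phi>) \<longlongrightarrow> l\<^sup>2 / pi) (at_left pi)" by (intro tendsto_intros) auto
        show "\<forall>\<^sub>F \<phi> in at_left pi. \<bar>T\<bar> \<le> l\<^sup>2 / \<phi>"
          unfolding eventually_at_left_field using b w pi_gt_zero by (intro exI[of _ 0]) auto
      qed simp
      \<comment> \<open>A full circle of radius \<open>norm a\<close> reaches the height
        \<open>4 * pi * (norm a)^2\<close> in absolute value; this fixes the radius, and the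
        direction is arbitrary.\<close>
      obtain a :: "complex ^ 'n" where a: "norm a = sqrt (\<bar>T\<bar> / (4 * pi))"
        using vector_choose_size[of "sqrt (\<bar>T\<bar> / (4 * pi))"] by auto
      show ?thesis
      proof (rule arc[of pi a])
        have "cis (- 2 * \<sigma> * pi) = 1"
          using \<sigma> by (auto simp: abs_if complex_eq_iff split: if_splits)
        then show "(\<chi> j. (cis (- 2 * \<sigma> * pi) - 1) * a $ j) = w" by (simp add: w vec_eq_iff)
        show "2 * (norm a)\<^sup>2 * (2 * pi - sin (2 * pi)) = \<bar>T\<bar>" by (simp add: a)
        show "2 * pi * norm a \<le> l"
        proof (rule power2_le_imp_le[OF _ l])
          have "(2 * pi * norm a)\<^sup>2 = 4 * pi * pi * (\<bar>T\<bar> / (4 * pi))"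
            by (simp add: a power_mult_distrib power2_eq_square[of pi])
          also have "\<dots> = pi * \<bar>T\<bar>" by simp
          also have "pi * \<bar>T\<bar> \<le> l\<^sup>2" using \<open>\<bar>T\<bar> \<le> l\<^sup>2 / pi\<close> by (simp add: field_simps)
          finally show "(2 * pi * norm a)\<^sup>2 \<le> l\<^sup>2" .
        qed
      qed simp
    next
      case w: False
      then have D: "0 < norm w" by simp
      obtain \<phi> where \<phi>: "0 < \<phi>" "\<phi> < pi" "\<phi> / (sin \<phi>)\<^sup>2 - cot \<phi> = \<bar>T\<bar> / (norm w)\<^sup>2"
        using arc_angle_exists[of "\<bar>T\<bar> / (norm w)\<^sup>2"] False D by auto
      have s: "0 < sin \<phi>" using \<phi> by (intro sin_gt_zero)
      have T: "\<bar>T\<bar> = (norm w)\<^sup>2 * (\<phi> / (sin \<phi>)\<^sup>2 - cot \<phi>)" using \<phi>(3) D by simp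
      define c where "c = cis (- 2 * \<sigma> * \<phi>) - 1"
      have "cmod c = 2 * \<bar>sin (- \<sigma> * \<phi>)\<bar>"
        using norm_cis_diff_one[of "- \<sigma> * \<phi>"] by (simp add: c_def mult.assoc)
      also have "\<bar>sin (- \<sigma> * \<phi>)\<bar> = sin \<phi>"
        using \<sigma> s by (auto simp: abs_if split: if_splits)
      finally have c: "cmod c = 2 * sin \<phi>" .
      then have "c \<noteq> 0" using s by auto
      \<comment> \<open>Dividing by \<open>c\<close> makes the planar arc end at \<open>w\<close>;
        since \<open>cmod c\<close> is \<open>2 * sin \<phi>\<close>, the radius is that of the
        circle with chord \<open>norm w\<close> and half-angle \<open>\<phi>\<close>.\<close>
      define a where "a = (\<chi> j. (1 / c) * w $ j)"
      have a: "norm a = norm w / (2 * sin \<phi>)"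
        unfolding a_def norm_cmult_vec by (simp add: norm_divide c)
      show ?thesis
      proof (rule arc[of \<phi> a])
        show "(\<chi> j. (cis (- 2 * \<sigma> * \<phi>) - 1) * a $ j) = w"
          unfolding c_def[symmetric] using \<open>c \<noteq> 0\<close> by (simp add: a_def vec_eq_iff)
        have "2 * (norm a)\<^sup>2 * (2 * \<phi> - sin (2 * \<phi>)) = (norm w)\<^sup>2 * ((\<phi> - sin \<phi> * cos \<phi>) / (sin \<phi>)\<^sup>2)"
          unfolding a sin_double using s by (simp add: power_divide power_mult_distrib field_simps)
        also have "(\<phi> - sin \<phi> * cos \<phi>) / (sin \<phi>)\<^sup>2 = \<phi> / (sin \<phi>)\<^sup>2 - cot \<phi>"
          using s by (simp add: cot_def power2_eq_square field_simps)
        finally show "2 * (norm a)\<^sup>2 * (2 * \<phi> - sin (2 * \<phi>)) = \<bar>T\<bar>" using T by simp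
        have "(norm w)\<^sup>2 * (\<phi> / (sin \<phi>)\<^sup>2) \<le> l\<^sup>2 / \<phi>"
          using b[OF \<phi>(1,2)] unfolding T by (simp add: algebra_simps)
        then have "(norm w)\<^sup>2 * (\<phi> / (sin \<phi>)\<^sup>2) * \<phi> \<le> l\<^sup>2"
          using \<phi>(1) by (simp only: pos_le_divide_eq)
        also have "(norm w)\<^sup>2 * (\<phi> / (sin \<phi>)\<^sup>2) * \<phi> = (2 * \<phi> * norm a)\<^sup>2"
          unfolding a by (simp add: power2_eq_square)
        finally show "2 * \<phi> * norm a \<le> l" using l by (rule power2_le_imp_le)
      qed (use \<phi> in simp)
    qed
  qed
qed

section \<open>The profile function and the sets $A_\lambda$\<close>

lemma mult_cos_less_sin:
  assumes "0 < \<phi>" "\<phi> \<le> pi"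
  shows "\<phi> * cos \<phi> < sin \<phi>"
proof -
  define f where "f = (\<lambda>x::real. sin x - x * cos x)"
  have "f 0 < f \<phi>"
  proof (rule DERIV_pos_imp_increasing_open[OF assms(1)])
    fix x assume x: "0 < x" "x < \<phi>"
    have "(f has_real_derivative x * sin x) (at x)"
      unfolding f_def by (auto intro!: derivative_eq_intros)
    moreover have "0 < x * sin x" using x assms by (intro mult_pos_pos sin_gt_zero) auto
    ultimately show "\<exists>y. (f has_real_derivative y) (at x) \<and> y > 0" by blast
  qed (auto intro!: continuous_intros simp: f_def)
  then show ?thesis by (simp add: f_def)
qed

lemma cot_le_inverse:
  assumes "0 < \<phi>" "\<phi> < pi"
  shows "cot \<phi> \<le> 1 / \<phi>"
proof -
  have "0 < sin \<phi>" using assms by (rule sin_gt_zero)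
  then show ?thesis using mult_cos_less_sin[of \<phi>] assms by (simp add: cot_def field_simps)
qed

lemma rho_less:
  assumes "0 \<le> x" "x < y" "y \<le> pi"
  shows "rho y < rho x"
\<comment> \<open>At 0 the value of \<open>rho\<close> is set by definition, so strictness there
  needs \<open>sin y < y\<close>, obtained by halving the angle. For positive \<open>x\<close> the
  sign of the derivative suffices.\<close>
proof (cases "x = 0")
  case True
  have "0 < sin (y / 2)" using assms True by (intro sin_gt_zero) auto
  moreover have "cos (y / 2) < 1" using cos_monotone_0_pi[of 0 "y / 2"] assms True by simp
  ultimately have "sin (y / 2) * cos (y / 2) < sin (y / 2)" by simp
  then have "sin y < y"
    using sin_double[of "y / 2"] sin_x_le_x[of "y / 2"] assms True by simp
  then show ?thesis using assms True by (simp add: rho_def)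
next
  case False
  then have "0 < x" using assms by simp
  define f where "f = (\<lambda>x::real. sin x / x)"
  have "f y < f x"
  proof (rule DERIV_neg_imp_decreasing_open[OF assms(2)])
    fix u assume u: "x < u" "u < y"
    then have "0 < u" using \<open>0 < x\<close> by simp
    then have "(f has_real_derivative (u * cos u - sin u) / u\<^sup>2) (at u)"
      unfolding f_def by (auto intro!: derivative_eq_intros simp: power2_eq_square mult.commute)
    moreover have "(u * cos u - sin u) / u\<^sup>2 < 0"
      using mult_cos_less_sin[of u] \<open>0 < u\<close> u assms by (intro divide_neg_pos) auto
    ultimately show "\<exists>l. (f has_real_derivative l) (at u) \<and> l < 0" by blast
  qed (use \<open>0 < x\<close> in \<open>auto intro!: continuous_intros simp: f_def\<close>)
  then show ?thesis using \<open>0 < x\<close> assms by (simp add: f_def rho_def)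
qed

lemma inv_into_rho: "x \<in> {0..pi} \<Longrightarrow> inv_into {0..pi} rho (rho x) = x"
  by (rule inv_into_f_f, rule linorder_inj_onI) (use rho_less in \<open>force+\<close>)

lemma h_fun_rho: "x \<in> {0..pi} \<Longrightarrow> h_fun (rho x) = g_fun x"
  by (simp add: h_fun_def inv_into_rho)

text \<open>
  As a function of \<open>r\<^sup>2\<close> the profile \<open>h\<close> is concave: it is the infimum over \<open>\<phi>\<close> of the affine
  functions \<open>1 / \<phi> - r\<^sup>2 cot \<phi>\<close>, attained where \<open>rho \<phi> = r\<close>.
\<close>

lemma g_fun_eq:
  assumes "0 < \<phi>" "\<phi> < pi"
  shows "g_fun \<phi> = 1 / \<phi> - cot \<phi> * (rho \<phi>)\<^sup>2"
proof -
  have "0 < sin \<phi>" using assms by (rule sin_gt_zero)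
  then show ?thesis using assms
    unfolding g_fun_def rho_def cot_def sin_double by (simp add: power2_eq_square field_simps)
qed

text \<open>For fixed \<open>r = rho \<psi>\<close> the right side, as a function \<open>k\<close>
  of the angle, has derivative \<open>(r^2 - (rho x)^2) / (sin x)^2\<close>. Since
  \<open>rho\<close> decreases, this changes sign from negative to positive at
  \<open>\<psi>\<close>, where \<open>k\<close> is therefore minimal.\<close>

lemma g_fun_le:
  assumes p: "0 < \<psi>" "\<psi> < pi" and q: "0 < \<phi>" "\<phi> < pi"
  shows "g_fun \<psi> \<le> 1 / \<phi> - cot \<phi> * (rho \<psi>)\<^sup>2"
proof -
  define r where "r = rho \<psi>"
  define k where "k = (\<lambda>x. 1 / x - cot x * r\<^sup>2)"
  have r0: "0 < r" using p by (simp add: r_def rho_def sin_gt_zero)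
  have d: "(k has_real_derivative (r\<^sup>2 - (rho x)\<^sup>2) / (sin x)\<^sup>2) (at x)" if "0 < x" "x < pi" for x
  proof -
    have s: "0 < sin x" using that by (rule sin_gt_zero)
    have "(k has_real_derivative - 1 / x\<^sup>2 - (- inverse ((sin x)\<^sup>2) * r\<^sup>2)) (at x)"
      unfolding k_def using that s
      by (intro DERIV_diff DERIV_cmult_right DERIV_cot) (auto intro!: derivative_eq_intros simp: power2_eq_square)
    also have "- 1 / x\<^sup>2 - (- inverse ((sin x)\<^sup>2) * r\<^sup>2) = (r\<^sup>2 - (rho x)\<^sup>2) / (sin x)\<^sup>2"
      using that s by (simp add: rho_def power_divide field_simps)
    finally show ?thesis .
  qed
  have "k \<psi> \<le> k \<phi>"
  proof (cases "\<phi> \<le> \<psi>")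
    case True
    show ?thesis
    proof (rule DERIV_nonpos_imp_nonincreasing[OF True])
      fix x assume x: "\<phi> \<le> x" "x \<le> \<psi>"
      have "r \<le> rho x" using x p q rho_less[of x \<psi>] by (cases "x = \<psi>") (auto simp: r_def)
      then have "r\<^sup>2 \<le> (rho x)\<^sup>2" using r0 by (intro power_mono) auto
      then show "\<exists>y. (k has_real_derivative y) (at x) \<and> y \<le> 0"
        using d[of x] x p q by (intro exI[of _ "(r\<^sup>2 - (rho x)\<^sup>2) / (sin x)\<^sup>2"]) (auto simp: divide_le_0_iff)
    qed
  next
    case False
    show ?thesis
    proof (rule DERIV_nonneg_imp_nondecreasing[of \<psi> \<phi>])
      show "\<psi> \<le> \<phi>" using False by simp
      fix x assume x: "\<psi> \<le> x" "x \<le> \<phi>"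
      have "rho x \<le> r" using x p q rho_less[of \<psi> x] by (cases "x = \<psi>") (auto simp: r_def)
      moreover have "0 \<le> rho x" using x p q sin_gt_zero[of x] by (simp add: rho_def)
      ultimately have "(rho x)\<^sup>2 \<le> r\<^sup>2" by (intro power_mono) auto
      then show "\<exists>y. (k has_real_derivative y) (at x) \<and> y \<ge> 0"
        using d[of x] x p q by (intro exI[of _ "(r\<^sup>2 - (rho x)\<^sup>2) / (sin x)\<^sup>2"]) (auto simp: zero_le_divide_iff)
    qed
  qed
  then show ?thesis using g_fun_eq[OF p] by (simp add: k_def r_def)
qed

lemma rho_surj:
  assumes "2 / pi < r" "r < 1"
  obtains \<phi> where "0 < \<phi>" "\<phi> < pi / 2" "rho \<phi> = r"
proof -
  \<comment> \<open>Solving \<open>r * x = sin x\<close> from 0 onwards would only return the root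
    0. At \<open>arccos r\<close> the difference is nonpositive because
    \<open>x * cos x < sin x\<close>, and at \<open>pi / 2\<close> it is nonnegative because
    \<open>2 / pi < r\<close>.\<close>
  define b where "b = arccos r"
  have r0: "0 < r" using assms(1) pi_gt_zero by (smt (verit) divide_pos_pos)
  have b: "0 < b" "b < pi / 2" "cos b = r"
    using assms r0 arccos_lt_bounded[of r] arccos_less_arccos[of 0 r] by (auto simp: b_def)
  have "r * b - sin b \<le> 0" using mult_cos_less_sin[of b] b by (simp add: mult.commute)
  moreover have "0 \<le> r * (pi / 2) - sin (pi / 2)" using assms by (simp add: field_simps)
  moreover have "continuous_on {b..pi / 2} (\<lambda>x. r * x - sin x)" by (intro continuous_intros)
  ultimately obtain \<phi> where \<phi>: "b \<le> \<phi>" "\<phi> \<le> pi / 2" "r * \<phi> - sin \<phi> = 0"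
    using IVT'[of "\<lambda>x. r * x - sin x" b 0 "pi / 2"] b by auto
  have "\<phi> \<noteq> pi / 2"
  proof
    assume "\<phi> = pi / 2"
    then have "r * (pi / 2) - sin (pi / 2) = 0" using \<phi>(3) by (simp only:)
    then have "r * pi = 2" by simp
    then show False using assms(1) by (simp add: field_simps)
  qed
  then have p: "0 < \<phi>" "\<phi> < pi / 2" using \<phi> b by auto
  then have "rho \<phi> = r" using \<phi>(3) by (simp add: rho_def divide_eq_eq)
  with p show thesis by (rule that)
qed

text \<open>Which constraint is sharp depends on \<open>r\<close>: on the flat part it is the one at
  \<open>pi / 2\<close>; for \<open>r\<close> strictly between \<open>lam / pi\<close> and
  \<open>lam / 2\<close> it is the one at the angle with \<open>rho \<psi> = 2 * r / lam\<close>; on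
  the rim the value 0 is only approached as the angle tends to 0.\<close>

lemma le_l_fun_iff:
  assumes lam: "0 < lam" and r: "0 \<le> r" "2 * r \<le> lam"
  shows "t \<le> l_fun lam r \<longleftrightarrow> (\<forall>\<phi>. 0 < \<phi> \<longrightarrow> \<phi> \<le> pi / 2 \<longrightarrow> t \<le> (lam / 2)\<^sup>2 / \<phi> - cot \<phi> * r\<^sup>2)"
proof -
  have cot0: "0 \<le> cot \<phi>" if "0 < \<phi>" "\<phi> \<le> pi / 2" for \<phi>
    using that unfolding cot_def by (intro divide_nonneg_nonneg cos_ge_zero sin_ge_zero) auto
  consider "r \<le> lam / pi" | "lam / pi < r" "2 * r < lam" | "lam / pi < r" "2 * r = lam"
    using r by linarith
  then show ?thesis
  proof cases
    case 1
    have l: "l_fun lam r = (lam / 2)\<^sup>2 * g_fun (pi / 2)"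
      using 1 by (simp add: l_fun_def g_fun_def power2_eq_square)
    have at: "(lam / 2)\<^sup>2 * g_fun (pi / 2) = (lam / 2)\<^sup>2 / (pi / 2) - cot (pi / 2) * r\<^sup>2"
      by (simp add: g_fun_def cot_def power2_eq_square)
    \<comment> \<open>The radius \<open>lam / pi\<close> corresponds to \<open>rho (pi / 2)\<close>.
      A smaller radius relaxes every constraint, because \<open>cot\<close> is nonnegative up to
      \<open>pi / 2\<close>.\<close>
    have le: "l_fun lam r \<le> (lam / 2)\<^sup>2 / \<phi> - cot \<phi> * r\<^sup>2" if \<phi>: "0 < \<phi>" "\<phi> \<le> pi / 2" for \<phi>
    proof -
      have "g_fun (pi / 2) \<le> 1 / \<phi> - cot \<phi> * (rho (pi / 2))\<^sup>2"
        using \<phi> by (intro g_fun_le) auto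
      then have "(lam / 2)\<^sup>2 * g_fun (pi / 2) \<le> (lam / 2)\<^sup>2 * (1 / \<phi> - cot \<phi> * (rho (pi / 2))\<^sup>2)"
        by (rule mult_left_mono) simp
      also have "\<dots> = (lam / 2)\<^sup>2 / \<phi> - cot \<phi> * (lam / pi)\<^sup>2"
        by (simp add: rho_def power_divide algebra_simps)
      also have "\<dots> \<le> (lam / 2)\<^sup>2 / \<phi> - cot \<phi> * r\<^sup>2"
        using 1 r cot0[OF \<phi>] by (intro diff_left_mono mult_left_mono power_mono) auto
      finally show ?thesis by (simp add: l)
    qed
    show ?thesis
    proof
      assume "\<forall>\<phi>. 0 < \<phi> \<longrightarrow> \<phi> \<le> pi / 2 \<longrightarrow> t \<le> (lam / 2)\<^sup>2 / \<phi> - cot \<phi> * r\<^sup>2"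
      then have "t \<le> (lam / 2)\<^sup>2 / (pi / 2) - cot (pi / 2) * r\<^sup>2"
        using pi_half_gt_zero order_refl by blast
      then show "t \<le> l_fun lam r" by (simp only: l at)
    qed (use le in \<open>blast intro: order_trans\<close>)
  next
    case 2
    obtain \<psi> where \<psi>: "0 < \<psi>" "\<psi> < pi / 2" "rho \<psi> = 2 * r / lam"
      using rho_surj[of "2 * r / lam"] 2 lam by (auto simp: field_simps)
    have rr: "r = lam / 2 * rho \<psi>" using \<psi>(3) lam by simp
    have "l_fun lam r = (lam / 2)\<^sup>2 * h_fun (rho \<psi>)"
      using 2 lam by (simp add: l_fun_def h_scaled_def rr)
    then have l: "l_fun lam r = (lam / 2)\<^sup>2 * g_fun \<psi>" using \<psi> h_fun_rho[of \<psi>] by simp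
    have eq: "(lam / 2)\<^sup>2 / \<phi> - cot \<phi> * r\<^sup>2 = (lam / 2)\<^sup>2 * (1 / \<phi> - cot \<phi> * (rho \<psi>)\<^sup>2)" for \<phi>
      unfolding rr power_mult_distrib by (simp add: algebra_simps)
    have le: "l_fun lam r \<le> (lam / 2)\<^sup>2 / \<phi> - cot \<phi> * r\<^sup>2" if \<phi>: "0 < \<phi>" "\<phi> \<le> pi / 2" for \<phi>
      unfolding eq l using \<phi> \<psi> by (intro mult_left_mono g_fun_le) auto
    have at: "l_fun lam r = (lam / 2)\<^sup>2 / \<psi> - cot \<psi> * r\<^sup>2"
      unfolding eq l using \<psi> by (simp add: g_fun_eq)
    show ?thesis
      using le \<psi> unfolding at by (auto intro: order_trans)
  next
    case 3
    \<comment> \<open>On the rim \<open>r / (lam / 2) = 1\<close>, whose preimage under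
      \<open>rho\<close> is 0, so the value of the profile is \<open>g_fun 0 = 0\<close>.\<close>
    have rho0: "rho 0 = 1" by (simp add: rho_def)
    have "h_fun 1 = 0" using h_fun_rho[of 0] by (simp add: rho0 g_fun_def)
    moreover have "r / (lam / 2) = 1" using 3 lam by simp
    ultimately have l: "l_fun lam r = 0"
      unfolding l_fun_def h_scaled_def using 3(1) by (simp only: not_le if_False) simp
    have rr: "r = lam / 2" using 3 by simp
    have eq: "(lam / 2)\<^sup>2 / \<phi> - cot \<phi> * r\<^sup>2 = (lam / 2)\<^sup>2 * (1 / \<phi> - cot \<phi>)" for \<phi>
      unfolding rr by (simp add: algebra_simps)
    have le: "0 \<le> (lam / 2)\<^sup>2 / \<phi> - cot \<phi> * r\<^sup>2" if \<phi>: "0 < \<phi>" "\<phi> \<le> pi / 2" for \<phi>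
      unfolding eq using cot_le_inverse[of \<phi>] \<phi> by (intro mult_nonneg_nonneg) auto
    \<comment> \<open>The gap \<open>1 / \<phi> - cot \<phi>\<close> is at most
      \<open>\<phi> / 2\<close>, so the constraints force \<open>t\<close> below quantities tending
      to 0.\<close>
    have "t \<le> 0" if t: "\<And>\<phi>. 0 < \<phi> \<Longrightarrow> \<phi> \<le> pi / 2 \<Longrightarrow> t \<le> (lam / 2)\<^sup>2 / \<phi> - cot \<phi> * r\<^sup>2"
    proof -
      have "t \<le> (lam / 2)\<^sup>2 * (\<phi> / 2)" if \<phi>: "0 < \<phi>" "\<phi> \<le> pi / 2" for \<phi>
      proof -
        have "1 - cos \<phi> = 2 * (sin (\<phi> / 2))\<^sup>2"
          using cos_double_sin[of "\<phi> / 2"] by simp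
        also have "\<dots> \<le> 2 * (\<phi> / 2)\<^sup>2"
          using \<phi> sin_x_le_x[of "\<phi> / 2"] by (intro mult_left_mono power_mono sin_ge_zero) auto
        finally have "1 - cos \<phi> \<le> \<phi>\<^sup>2 / 2" by (simp add: power_divide)
        then have "1 - \<phi> * cot \<phi> \<le> \<phi>\<^sup>2 / 2" using cos_le_mult_cot[OF \<phi>] by linarith
        then have "1 / \<phi> - cot \<phi> \<le> \<phi> / 2" using \<phi>(1) by (simp add: power2_eq_square field_simps)
        then have "(lam / 2)\<^sup>2 * (1 / \<phi> - cot \<phi>) \<le> (lam / 2)\<^sup>2 * (\<phi> / 2)"
          by (rule mult_left_mono) simp
        then show ?thesis using t[OF \<phi>] unfolding eq by linarith
      qed
      then have "\<forall>\<^sub>F \<phi> in at_right 0. t \<le> (lam / 2)\<^sup>2 * (\<phi> / 2)"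
        unfolding eventually_at_right_field by (intro exI[of _ "pi / 2"]) auto
      moreover have "((\<lambda>\<phi>. (lam / 2)\<^sup>2 * (\<phi> / 2)) \<longlongrightarrow> (lam / 2)\<^sup>2 * (0 / 2)) (at_right 0)"
        by (intro tendsto_intros) simp
      ultimately have "t \<le> (lam / 2)\<^sup>2 * (0 / 2)"
        by (intro tendsto_lowerbound[of "\<lambda>\<phi>. (lam / 2)\<^sup>2 * (\<phi> / 2)" _ "at_right 0"]) auto
      then show ?thesis by simp
    qed
    then show ?thesis unfolding l using le by (auto intro: order_trans)
  qed
qed

section \<open>Convexity, compactness and interior of the sets \<open>A_set lam\<close>\<close>

lemma mem_A_set_iff:
  assumes "0 < lam"
  shows "p \<in> A_set lam \<longleftrightarrow> 2 * norm (fst p) \<le> lam \<and>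
    (\<forall>\<phi>. 0 < \<phi> \<longrightarrow> \<phi> \<le> pi / 2 \<longrightarrow> \<bar>snd p\<bar> + cot \<phi> * (norm (fst p))\<^sup>2 \<le> (lam / 2)\<^sup>2 / \<phi>)"
proof (cases "2 * norm (fst p) \<le> lam")
  case True
  then show ?thesis
    using le_l_fun_iff[OF assms norm_ge_zero True, of "\<bar>snd p\<bar>"]
    by (simp add: A_set_def split_beta le_diff_eq)
qed (auto simp: A_set_def)

lemma A_set_eq_INT:
  assumes "0 < lam"
  shows "A_set lam = {p. 2 * norm (fst p) \<le> lam} \<inter>
    (\<Inter>\<phi>\<in>{0<..pi / 2}. {p. \<bar>snd p\<bar> + cot \<phi> * (norm (fst p))\<^sup>2 \<le> (lam / 2)\<^sup>2 / \<phi>})"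
  by (auto simp: mem_A_set_iff[OF assms])

text \<open>An intersection of sublevel sets of convex functions, the factor
  \<open>cot \<phi>\<close> being nonnegative on the angles that occur. Convexity is what later
  makes the set the closure of its interior.\<close>

lemma convex_A_set:
  assumes "0 < lam"
  shows "convex (A_set lam :: 'n::finite heis set)"
proof -
  have 1: "convex {p :: 'n heis. 2 * norm (fst p) \<le> lam}"
  proof (rule convexI)
    fix x y :: "'n heis" and u v :: real
    assume *: "x \<in> {p. 2 * norm (fst p) \<le> lam}" "y \<in> {p. 2 * norm (fst p) \<le> lam}" "0 \<le> u" "0 \<le> v" "u + v = 1"
    have "norm (u *\<^sub>R fst x + v *\<^sub>R fst y) \<le> u * norm (fst x) + v * norm (fst y)"
      using norm_triangle_ineq[of "u *\<^sub>R fst x" "v *\<^sub>R fst y"] * by simp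
    also have "\<dots> \<le> lam / 2"
      using * by (intro convex_bound_le) auto
    finally show "u *\<^sub>R x + v *\<^sub>R y \<in> {p. 2 * norm (fst p) \<le> lam}" by simp
  qed
  have 2: "convex {p :: 'n heis. \<bar>snd p\<bar> + k * (norm (fst p))\<^sup>2 \<le> c}" if "0 \<le> k" for k c
  proof (rule convexI)
    fix x y :: "'n heis" and u v :: real
    assume *: "x \<in> {p. \<bar>snd p\<bar> + k * (norm (fst p))\<^sup>2 \<le> c}" "y \<in> {p. \<bar>snd p\<bar> + k * (norm (fst p))\<^sup>2 \<le> c}" "0 \<le> u" "0 \<le> v" "u + v = 1"
    have "norm (u *\<^sub>R fst x + v *\<^sub>R fst y) \<le> u * norm (fst x) + v * norm (fst y)"
      using norm_triangle_ineq[of "u *\<^sub>R fst x" "v *\<^sub>R fst y"] * by simp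
    then have "(norm (u *\<^sub>R fst x + v *\<^sub>R fst y))\<^sup>2 \<le> (u * norm (fst x) + v * norm (fst y))\<^sup>2"
      by (rule power_mono) simp
    also have "\<dots> \<le> u * (norm (fst x))\<^sup>2 + v * (norm (fst y))\<^sup>2"
    proof -
      have "u * (norm (fst x))\<^sup>2 + v * (norm (fst y))\<^sup>2 - (u * norm (fst x) + v * norm (fst y))\<^sup>2
          = u * v * (norm (fst x) - norm (fst y))\<^sup>2"
      proof -
        have v: "v = 1 - u" using *(5) by simp
        show ?thesis unfolding v by (simp add: power2_eq_square algebra_simps)
      qed
      moreover have "0 \<le> u * v * (norm (fst x) - norm (fst y))\<^sup>2" using * by simp
      ultimately show ?thesis by linarith
    qed
    finally have "k * (norm (u *\<^sub>R fst x + v *\<^sub>R fst y))\<^sup>2 \<le> k * (u * (norm (fst x))\<^sup>2 + v * (norm (fst y))\<^sup>2)"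
      using that by (rule mult_left_mono)
    moreover have "\<bar>u * snd x + v * snd y\<bar> \<le> u * \<bar>snd x\<bar> + v * \<bar>snd y\<bar>"
      using abs_triangle_ineq[of "u * snd x" "v * snd y"] * by (simp add: abs_mult)
    moreover have "u * (\<bar>snd x\<bar> + k * (norm (fst x))\<^sup>2) + v * (\<bar>snd y\<bar> + k * (norm (fst y))\<^sup>2) \<le> c"
      using * by (intro convex_bound_le) auto
    ultimately show "u *\<^sub>R x + v *\<^sub>R y \<in> {p. \<bar>snd p\<bar> + k * (norm (fst p))\<^sup>2 \<le> c}"
      by (simp add: algebra_simps)
  qed
  show ?thesis
    unfolding A_set_eq_INT[OF assms]
  proof (intro convex_Int convex_INT 1 2)
    fix \<phi> :: real assume "\<phi> \<in> {0<..pi / 2}"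
    then show "0 \<le> cot \<phi>"
      unfolding cot_def by (intro divide_nonneg_nonneg cos_ge_zero sin_ge_zero) auto
  qed
qed

lemma compact_A_set:
  assumes "0 < lam"
  shows "compact (A_set lam :: 'n::finite heis set)"
  unfolding compact_eq_bounded_closed
proof
  show "closed (A_set lam :: 'n heis set)"
    unfolding A_set_eq_INT[OF assms]
    by (intro closed_Int closed_INT ballI closed_Collect_le continuous_intros)
  have "A_set lam \<subseteq> cball (0 :: complex ^ 'n) (lam / 2) \<times> cball 0 ((lam / 2)\<^sup>2 / (pi / 2))"
  proof
    fix p :: "'n heis" assume "p \<in> A_set lam"
    then have "2 * norm (fst p) \<le> lam" "\<bar>snd p\<bar> + cot (pi / 2) * (norm (fst p))\<^sup>2 \<le> (lam / 2)\<^sup>2 / (pi / 2)"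
      unfolding mem_A_set_iff[OF assms] using pi_half_gt_zero order_refl by blast+
    then show "p \<in> cball 0 (lam / 2) \<times> cball 0 ((lam / 2)\<^sup>2 / (pi / 2))"
      by (simp add: mem_Times_iff cot_def)
  qed
  then show "bounded (A_set lam :: 'n heis set)"
    by (rule bounded_subset[rotated]) (intro bounded_Times bounded_cball)
qed

lemma interior_A_set_nonempty:
  assumes "0 < lam"
  shows "interior (A_set lam :: 'n::finite heis set) \<noteq> {}"
proof -
  \<comment> \<open>With \<open>cot \<phi>\<close> at most \<open>1 / \<phi>\<close>, the vertical
    term uses at most half and the planar term at most a quarter of the allowance
    \<open>(lam / 2)^2 / \<phi>\<close>.\<close>
  let ?U = "{p :: 'n heis. norm (fst p) < lam / 4 \<and> \<bar>snd p\<bar> < lam\<^sup>2 / (4 * pi)}"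
  have "open ?U" by (intro open_Collect_conj open_Collect_less continuous_intros)
  moreover have "?U \<subseteq> A_set lam"
  proof
    fix p :: "'n heis" assume p: "p \<in> ?U"
    have "\<bar>snd p\<bar> + cot \<phi> * (norm (fst p))\<^sup>2 \<le> (lam / 2)\<^sup>2 / \<phi>" if \<phi>: "0 < \<phi>" "\<phi> \<le> pi / 2" for \<phi>
    proof -
      have "(norm (fst p))\<^sup>2 \<le> (lam / 4)\<^sup>2" using p by (intro power_mono) auto
      moreover have "cot \<phi> \<le> 1 / \<phi>" using \<phi> by (intro cot_le_inverse) auto
      ultimately have "cot \<phi> * (norm (fst p))\<^sup>2 \<le> 1 / \<phi> * (lam / 4)\<^sup>2"
        using \<phi> by (intro mult_mono) auto
      moreover have "lam\<^sup>2 / (4 * pi) \<le> lam\<^sup>2 / (8 * \<phi>)"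
        using \<phi> by (intro divide_left_mono) auto
      moreover have "lam\<^sup>2 / (8 * \<phi>) + 1 / \<phi> * (lam / 4)\<^sup>2 \<le> (lam / 2)\<^sup>2 / \<phi>"
        using \<phi> by (simp add: power_divide field_simps)
      ultimately show ?thesis using p by simp
    qed
    then show "p \<in> A_set lam" using p assms by (simp add: mem_A_set_iff)
  qed
  moreover have "0 \<in> ?U" using assms by simp
  ultimately have "0 \<in> interior (A_set lam :: 'n heis set)" using interior_maximal by blast
  then show ?thesis by blast
qed

section \<open>Diameters of rotationally invariant sets\<close>

lemma cot_half_identity:
  assumes "0 < \<phi>" "\<phi> < pi"
  shows "sin \<phi> * cot (\<phi> / 2) = 1 + cos \<phi>"
proof -
  have s: "0 < sin (\<phi> / 2)" using assms by (intro sin_gt_zero) auto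
  have "sin \<phi> = 2 * sin (\<phi> / 2) * cos (\<phi> / 2)" using sin_double[of "\<phi> / 2"] by simp
  moreover have "1 + cos \<phi> = 2 * (cos (\<phi> / 2))\<^sup>2" using cos_double_cos[of "\<phi> / 2"] by simp
  ultimately show ?thesis using s by (simp add: cot_def power2_eq_square)
qed

text \<open>Multiplied by \<open>sin \<phi>\<close> this says that \<open>\<parallel>z + e\<^sup>\<plusminus>\<^sup>i\<^sup>\<phi> z'\<parallel>\<^sup>2\<close> is nonnegative.\<close>

lemma im_form_cot_le:
  fixes z z' :: "complex ^ 'n::finite"
  assumes \<phi>: "0 < \<phi>" "\<phi> < pi"
  shows "2 * \<bar>im_form z z'\<bar> \<le> ((norm z)\<^sup>2 + (norm z')\<^sup>2) * cot (\<phi> / 2) - cot \<phi> * (norm (z' - z))\<^sup>2"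
proof -
  have s: "0 < sin \<phi>" using \<phi> by (rule sin_gt_zero)
  have n: "(norm (z' - z))\<^sup>2 = (norm z)\<^sup>2 + (norm z')\<^sup>2 - 2 * (z \<bullet> z')"
    by (simp add: power2_norm_eq_inner algebra_simps inner_commute)
  have "- cos \<phi> * (z \<bullet> z') + sin \<phi> * im_form z z' \<le> norm z * norm z'"
    using rotated_inner_le[of "pi - \<phi>" z z'] by simp
  moreover have "- cos \<phi> * (z \<bullet> z') - sin \<phi> * im_form z z' \<le> norm z * norm z'"
    using rotated_inner_le[of "\<phi> + pi" z z'] by simp
  ultimately have "sin \<phi> * \<bar>im_form z z'\<bar> \<le> norm z * norm z' + cos \<phi> * (z \<bullet> z')"
    by (cases "0 \<le> im_form z z'") auto
  moreover have "2 * (norm z * norm z') \<le> (norm z)\<^sup>2 + (norm z')\<^sup>2"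
    using sum_squares_bound[of "norm z" "norm z'"] by simp
  ultimately have "sin \<phi> * (2 * \<bar>im_form z z'\<bar>) \<le> (norm z)\<^sup>2 + (norm z')\<^sup>2 + 2 * cos \<phi> * (z \<bullet> z')"
    by (simp add: algebra_simps)
  also have "\<dots> = ((norm z)\<^sup>2 + (norm z')\<^sup>2) * (sin \<phi> * cot (\<phi> / 2)) - (sin \<phi> * cot \<phi>) * (norm (z' - z))\<^sup>2"
    unfolding cot_half_identity[OF \<phi>] n using s by (simp add: cot_def algebra_simps)
  also have "\<dots> = sin \<phi> * (((norm z)\<^sup>2 + (norm z')\<^sup>2) * cot (\<phi> / 2) - cot \<phi> * (norm (z' - z))\<^sup>2)"
    by (simp add: algebra_simps)
  finally show ?thesis using s by (simp only: mult_le_cancel_left_pos)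
qed

lemma norm_le_cc_dist: "ennreal (norm (fst q - fst p)) \<le> cc_dist p q"
proof (cases "cc_dist p q")
  case (real x)
  then show ?thesis using cc_dist_leD_norm[of p q x] by (simp add: ennreal_leI)
qed simp

lemma cc_dist_le_cc_diam: "p \<in> E \<Longrightarrow> q \<in> E \<Longrightarrow> cc_dist p q \<le> cc_diam E"
  unfolding cc_diam_def by (rule SUP_upper2[of p E], assumption, rule SUP_upper)

text \<open>For the upper bound, the distance inequality at \<open>\<phi>\<close> follows by adding
  the defining inequalities of both points at \<open>\<phi> / 2\<close> to
  \<open>im_form_cot_le\<close>. For the lower bound, two antipodal rim points at height 0 have
  planar distance \<open>lam\<close>.\<close>

lemma cc_diam_A_set:
  assumes lam: "0 < lam"
  shows "cc_diam (A_set lam :: 'n::finite heis set) = ennreal lam"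
proof (rule antisym)
  show "cc_diam (A_set lam :: 'n heis set) \<le> ennreal lam"
    unfolding cc_diam_def
  proof (intro SUP_least cc_dist_leI)
    fix p q :: "'n heis" and \<phi> assume p: "p \<in> A_set lam" and q: "q \<in> A_set lam" and \<phi>: "0 < \<phi>" "\<phi> < pi"
    have pq: "\<bar>snd r\<bar> + cot (\<phi> / 2) * (norm (fst r))\<^sup>2 \<le> lam\<^sup>2 / (2 * \<phi>)" if "r \<in> A_set lam" for r :: "'n heis"
    proof -
      have "0 < \<phi> / 2" "\<phi> / 2 \<le> pi / 2" using \<phi> by auto
      then have "\<bar>snd r\<bar> + cot (\<phi> / 2) * (norm (fst r))\<^sup>2 \<le> (lam / 2)\<^sup>2 / (\<phi> / 2)"
        using that unfolding mem_A_set_iff[OF lam] by blast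
      then show ?thesis by (simp add: power_divide)
    qed
    have "\<bar>T_offset p q\<bar> \<le> \<bar>snd p\<bar> + \<bar>snd q\<bar> + 2 * \<bar>im_form (fst p) (fst q)\<bar>"
      unfolding T_offset_def by linarith
    also have "\<dots> \<le> 2 * (lam\<^sup>2 / (2 * \<phi>)) - cot \<phi> * (norm (fst q - fst p))\<^sup>2"
      using pq[OF p] pq[OF q] im_form_cot_le[OF \<phi>, of "fst p" "fst q"] by (simp add: algebra_simps)
    finally show "\<bar>T_offset p q\<bar> \<le> lam\<^sup>2 / \<phi> - cot \<phi> * (norm (fst q - fst p))\<^sup>2" by simp
  qed (use lam in simp)
  obtain z :: "complex ^ 'n" where z: "norm z = lam / 2"
    using vector_choose_size[of "lam / 2"] lam by auto
  have mem: "(w, 0) \<in> A_set lam" if w: "norm w = lam / 2" for w :: "complex ^ 'n"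
    unfolding mem_A_set_iff[OF lam]
  proof (intro conjI allI impI)
    fix \<phi> :: real assume \<phi>: "0 < \<phi>" "\<phi> \<le> pi / 2"
    have "cot \<phi> * (lam / 2)\<^sup>2 \<le> 1 / \<phi> * (lam / 2)\<^sup>2"
      using cot_le_inverse[of \<phi>] \<phi> by (intro mult_right_mono) auto
    then show "\<bar>snd (w, 0)\<bar> + cot \<phi> * (norm (fst (w, 0)))\<^sup>2 \<le> (lam / 2)\<^sup>2 / \<phi>"
      by (simp add: w)
  qed (simp add: w)
  have "norm (- z - z) = norm ((- 2) *\<^sub>R z)" by (simp add: scaleR_2 del: norm_scaleR)
  then have "norm (- z - z) = lam" using z by simp
  then have "ennreal lam \<le> cc_dist (z, 0) (- z, 0)"
    using norm_le_cc_dist[of "(- z, 0)" "(z, 0)"] by simp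
  also have "\<dots> \<le> cc_diam (A_set lam :: 'n heis set)"
    using mem[of z] mem[of "- z"] z by (intro cc_dist_le_cc_diam) auto
  finally show "ennreal lam \<le> cc_diam (A_set lam :: 'n heis set)" .
qed

lemma A_set_rot_invariant: "(A_set lam :: 'n::finite heis set) \<in> rot_invariant"
proof -
  have "norm (\<chi> j. cis (\<theta> $ j) * z $ j) = norm z" for \<theta> :: "real ^ 'n" and z :: "complex ^ 'n"
    by (simp add: norm_vec_def norm_mult)
  then show ?thesis by (auto simp: rot_invariant_def rot_def A_set_def)
qed

section \<open>Constraints on rotationally invariant sets of bounded diameter\<close>

lemma rot_const_mem:
  assumes "E \<in> rot_invariant" "(z, t) \<in> E"
  shows "((\<chi> j. cis \<theta> * z $ j), t) \<in> E"
proof -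
  have "rot (\<chi> j. \<theta>) (z, t) \<in> E" using assms unfolding rot_invariant_def by blast
  then show ?thesis by (simp add: rot_def)
qed

text \<open>Rotation by \<open>pi\<close> puts \<open>- z\<close> at the same height into
  \<open>E\<close>, and the distance is at least the planar distance
  \<open>2 * norm z\<close>.\<close>

lemma rot_invariant_norm_le:
  assumes E: "E \<in> rot_invariant" "cc_diam E \<le> ennreal lam" and lam: "0 < lam" and z: "(z, t) \<in> E"
  shows "2 * norm z \<le> lam"
proof -
  have "(- z, t) \<in> E"
  proof -
    have "(\<chi> j. cis pi * z $ j) = - z" by (simp add: vec_eq_iff)
    then show ?thesis using rot_const_mem[OF E(1) z, of pi] by simp
  qed
  then have "cc_dist (z, t) (- z, t) \<le> ennreal lam"
    using cc_dist_le_cc_diam[OF z] E(2) order_trans by blast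
  then have "norm (- z - z) \<le> lam"
    using cc_dist_leD_norm[of "(z, t)" "(- z, t)" lam] lam by simp
  moreover have "norm (- z - z) = norm ((- 2) *\<^sub>R z)" by (simp add: scaleR_2 del: norm_scaleR)
  ultimately show ?thesis by simp
qed

text \<open>Comparing one point of the slice with a rotated copy of the other gives, for every
  rotation angle, one of the inequalities that characterize \<open>l_fun\<close>.\<close>

lemma rot_invariant_slice_diff_le:
  assumes E: "E \<in> rot_invariant" "cc_diam E \<le> ennreal lam" and lam: "0 < lam"
    and z: "(z, t) \<in> E" "(z, s) \<in> E"
  shows "\<bar>s - t\<bar> \<le> 2 * l_fun lam (norm z)"
proof -
  have *: "(s - t) / 2 \<le> (lam / 2)\<^sup>2 / \<phi> - cot \<phi> * (norm z)\<^sup>2"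
    if z: "(z, t) \<in> E" "(z, s) \<in> E" and \<phi>: "0 < \<phi>" "\<phi> < pi / 2" for s t \<phi>
  proof -
    \<comment> \<open>With this angle the chord from \<open>z\<close> to its rotation has length
      \<open>2 * cos \<phi> * norm z\<close>, and the distance inequality at
      \<open>2 * \<phi>\<close> becomes the profile inequality at \<open>\<phi>\<close>.\<close>
    define \<theta> where "\<theta> = 2 * (pi / 2 - \<phi>)"
    define w where "w = (\<chi> j. cis \<theta> * z $ j)"
    have "(w, s) \<in> E" unfolding w_def by (rule rot_const_mem[OF E(1) z(2)])
    then have d: "cc_dist (z, t) (w, s) \<le> ennreal lam"
      using cc_dist_le_cc_diam[OF z(1)] E(2) order_trans by blast
    have "w - z = (\<chi> j. (cis \<theta> - 1) * z $ j)" by (simp add: w_def vec_eq_iff algebra_simps)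
    then have "norm (w - z) = 2 * \<bar>sin (pi / 2 - \<phi>)\<bar> * norm z"
      unfolding \<theta>_def by (simp only: norm_cmult_vec norm_cis_diff_one)
    then have n: "(norm (w - z))\<^sup>2 = 4 * (cos \<phi>)\<^sup>2 * (norm z)\<^sup>2"
      by (simp add: power_mult_distrib sin_diff)
    have "im_form z w = (\<Sum>j\<in>UNIV. - sin \<theta> * (cmod (z $ j))\<^sup>2)"
      unfolding im_form_def
    proof (rule sum.cong[OF refl])
      fix j
      have "z $ j * cnj (w $ j) = cis (- \<theta>) * (z $ j * cnj (z $ j))" by (simp add: w_def cis_cnj)
      also have "z $ j * cnj (z $ j) = of_real ((cmod (z $ j))\<^sup>2)" by (rule complex_norm_square[symmetric])
      finally show "Im (z $ j * cnj (w $ j)) = - sin \<theta> * (cmod (z $ j))\<^sup>2" by (simp del: of_real_power)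
    qed
    also have "\<dots> = - sin \<theta> * (norm z)\<^sup>2" by (simp add: norm_vec_def L2_set_def sum_nonneg sum_distrib_left)
    finally have im: "im_form z w = - sin \<theta> * (norm z)\<^sup>2" .
    have sin\<theta>: "sin \<theta> = sin (2 * \<phi>)" by (simp add: \<theta>_def right_diff_distrib)
    have s0: "0 < sin \<phi>" using \<phi> by (intro sin_gt_zero) auto
    have c0: "0 < cos \<phi>" using \<phi> by (intro cos_gt_zero) auto
    have "\<bar>T_offset (z, t) (w, s)\<bar> \<le> lam\<^sup>2 / (2 * \<phi>) - cot (2 * \<phi>) * (norm (w - z))\<^sup>2"
      using cc_dist_leD[OF d, of "2 * \<phi>"] lam \<phi> by simp
    then have "s - t \<le> lam\<^sup>2 / (2 * \<phi>) - (cot (2 * \<phi>) * (4 * (cos \<phi>)\<^sup>2) + 2 * sin (2 * \<phi>)) * (norm z)\<^sup>2"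
      by (simp add: T_offset_def im n sin\<theta> algebra_simps)
    also have "cot (2 * \<phi>) * (4 * (cos \<phi>)\<^sup>2) + 2 * sin (2 * \<phi>) = 2 * cot \<phi>"
    proof -
      have "cot (2 * \<phi>) * (4 * (cos \<phi>)\<^sup>2) = 2 * cos \<phi> * ((cos \<phi>)\<^sup>2 - (sin \<phi>)\<^sup>2) / sin \<phi>"
        unfolding cot_def sin_double cos_double using s0 c0 by (simp add: power2_eq_square field_simps)
      moreover have "2 * sin (2 * \<phi>) = 2 * cos \<phi> * (2 * (sin \<phi>)\<^sup>2) / sin \<phi>"
        unfolding sin_double using s0 by (simp add: power2_eq_square)
      ultimately have "cot (2 * \<phi>) * (4 * (cos \<phi>)\<^sup>2) + 2 * sin (2 * \<phi>)
          = (2 * cos \<phi> * ((cos \<phi>)\<^sup>2 - (sin \<phi>)\<^sup>2) + 2 * cos \<phi> * (2 * (sin \<phi>)\<^sup>2)) / sin \<phi>"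
        by (simp only: add_divide_distrib)
      also have "2 * cos \<phi> * ((cos \<phi>)\<^sup>2 - (sin \<phi>)\<^sup>2) + 2 * cos \<phi> * (2 * (sin \<phi>)\<^sup>2)
          = 2 * cos \<phi> * ((cos \<phi>)\<^sup>2 + (sin \<phi>)\<^sup>2)"
        by algebra
      finally show ?thesis by (simp add: cot_def)
    qed
    finally show ?thesis by (simp add: power_divide)
  qed
  \<comment> \<open>At \<open>\<phi> = pi / 2\<close> the doubled angle would be \<open>pi\<close>,
    outside the range of the distance inequality, so this constraint follows by continuity.\<close>
  have pi2: "(s - t) / 2 \<le> (lam / 2)\<^sup>2 / \<phi> - cot \<phi> * (norm z)\<^sup>2"
    if z: "(z, t) \<in> E" "(z, s) \<in> E" and \<phi>: "0 < \<phi>" "\<phi> \<le> pi / 2" for s t \<phi>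
  proof (cases "\<phi> = pi / 2")
    case True
    have "((\<lambda>\<phi>. (lam / 2)\<^sup>2 / \<phi> - cot \<phi> * (norm z)\<^sup>2) \<longlongrightarrow> (lam / 2)\<^sup>2 / (pi / 2) - cot (pi / 2) * (norm z)\<^sup>2) (at_left (pi / 2))"
      by (intro tendsto_intros) auto
    moreover have "\<forall>\<^sub>F \<phi> in at_left (pi / 2). (s - t) / 2 \<le> (lam / 2)\<^sup>2 / \<phi> - cot \<phi> * (norm z)\<^sup>2"
      unfolding eventually_at_left_field using *[OF z] pi_half_gt_zero by blast
    ultimately show ?thesis unfolding True by (rule tendsto_lowerbound) simp
  qed (use * z \<phi> in auto)
  have "\<bar>s - t\<bar> / 2 \<le> l_fun lam (norm z)"
    using pi2[OF z] pi2[OF z(2,1)] unfolding le_l_fun_iff[OF lam norm_ge_zero rot_invariant_norm_le[OF E lam z(1)]]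
    by (cases "t \<le> s") auto
  then show ?thesis by simp
qed

text \<open>A slice of diameter at most \<open>2 * l\<close> lies in an interval of that length. Its
  outer measure is then at most \<open>2 * l\<close>, so its symmetrization stays within height
  \<open>l\<close>.\<close>

lemma steiner_subset_A_set:
  assumes E: "E \<in> rot_invariant" "cc_diam E \<le> ennreal lam" and lam: "0 < lam"
  shows "steiner E \<subseteq> A_set lam"
proof
  fix p assume p: "p \<in> steiner E"
  obtain z t where [simp]: "p = (z, t)" by (cases p)
  define S where "S = {s. (z, s) \<in> E}"
  obtain s0 where s0: "s0 \<in> S" and t: "ennreal (2 * \<bar>t\<bar>) \<le> leb_outer S"
    using p by (auto simp: steiner_def S_def)
  define l where "l = l_fun lam (norm z)"
  have diff: "\<bar>s - s'\<bar> \<le> 2 * l" if "s \<in> S" "s' \<in> S" for s s'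
    unfolding l_def using that by (intro rot_invariant_slice_diff_le[OF E lam]) (auto simp: S_def)
  have l0: "0 \<le> l" using diff[OF s0 s0] by simp
  have bdd: "bdd_below S"
    using diff[OF _ s0] by (intro bdd_belowI[of _ "s0 - 2 * l"]) (force simp: abs_le_iff)
  have "S \<subseteq> {Inf S..Inf S + 2 * l}"
  proof
    fix s assume s: "s \<in> S"
    have "s - 2 * l \<le> Inf S"
      using s0 diff[OF s] by (intro cInf_greatest) (auto simp: abs_le_iff algebra_simps)
    then show "s \<in> {Inf S..Inf S + 2 * l}" using cInf_lower[OF s bdd] by simp
  qed
  then have "leb_outer S \<le> leb_outer {Inf S..Inf S + 2 * l}" by (rule outer_measure_of_mono)
  also have "\<dots> = ennreal (2 * l)" using l0 by simp
  finally have "ennreal (2 * \<bar>t\<bar>) \<le> ennreal (2 * l)" using t by (rule order_trans[rotated])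
  then have "\<bar>t\<bar> \<le> l" using l0 by (simp add: ennreal_le_iff)
  moreover have "2 * norm z \<le> lam"
    using rot_invariant_norm_le[OF E lam] s0 by (auto simp: S_def)
  ultimately show "p \<in> A_set lam" by (simp add: A_set_def l_def)
qed

section \<open>Steiner symmetrization\<close>

lemma leb_outer_borel: "A \<in> sets borel \<Longrightarrow> leb_outer A = emeasure lborel A"
  by simp

lemma slice_closed:
  assumes "closed E"
  shows "closed {s. (z, s) \<in> E}"
proof -
  have "closed (Pair z -` E)" using assms by (intro closed_vimage continuous_intros)
  then show ?thesis by (simp add: vimage_def)
qed

text \<open>This amounts to upper semicontinuity of the measure of the vertical slices of \<open>E\<close>.\<close>

lemma closed_steiner:
  assumes E: "compact E"
  shows "closed (steiner E)"
  unfolding closed_sequential_limits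
proof (intro allI impI)
  fix x p assume "(\<forall>n. x n \<in> steiner E) \<and> x \<longlonglongrightarrow> p"
  then have x: "\<And>n. x n \<in> steiner E" and lim: "x \<longlonglongrightarrow> p" by auto
  have clE: "closed E" using E by (rule compact_imp_closed)
  define z where "z = (\<lambda>n. fst (x n))"
  define S where "S = (\<lambda>w. {s. (w, s) \<in> E})"
  have Sb: "S w \<in> sets borel" for w unfolding S_def using slice_closed[OF clE] by (rule borel_closed)
  have zl: "z \<longlonglongrightarrow> fst p" unfolding z_def by (intro tendsto_intros lim)
  have zE: "z n \<in> fst ` E" for n using x[of n] by (force simp: steiner_def z_def)
  have "closed (fst ` E)"
    by (intro compact_imp_closed compact_continuous_image continuous_intros E)
  then have pE: "fst p \<in> fst ` E" using zE zl by (metis closed_sequentially)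
  obtain M where M: "\<And>y. y \<in> E \<Longrightarrow> norm y \<le> M"
    using compact_imp_bounded[OF E] unfolding bounded_iff by blast
  have SM: "S w \<subseteq> {-M..M}" for w
  proof
    fix s assume "s \<in> S w"
    then have "norm (w, s) \<le> M" using M by (simp add: S_def)
    then show "s \<in> {-M..M}" using norm_snd_le[of s w] by (auto simp: abs_le_iff)
  qed
  \<comment> \<open>The intersection of these decreasing unions consists of heights lying over
    infinitely many \<open>z n\<close>. As \<open>E\<close> is closed, they belong to the slice over
    the limit, and continuity of measure from above transfers the bounds.\<close>
  define B where "B = (\<lambda>n. \<Union>k\<in>{n..}. S (z k))"
  have Bb: "range B \<subseteq> sets lborel" unfolding B_def using Sb by auto
  have decB: "decseq B" unfolding B_def by (intro antimonoI UN_mono) auto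
  have fin: "emeasure lborel (B n) \<noteq> \<infinity>" for n
  proof -
    have "emeasure lborel (B n) \<le> emeasure lborel {-M..M}"
      using SM by (intro emeasure_mono) (auto simp: B_def)
    also have "\<dots> < \<infinity>" by (intro emeasure_bounded_finite) simp
    finally show ?thesis by simp
  qed
  have lB: "(\<lambda>n. emeasure lborel (B n)) \<longlonglongrightarrow> emeasure lborel (\<Inter>n. B n)"
    by (rule Lim_emeasure_decseq[OF Bb decB fin])
  have "(\<Inter>n. B n) \<subseteq> S (fst p)"
  proof
    fix s assume s: "s \<in> (\<Inter>n. B n)"
    show "s \<in> S (fst p)"
    proof (rule ccontr)
      assume "s \<notin> S (fst p)"
      then have "(fst p, s) \<in> - E" by (simp add: S_def)
      moreover have "(\<lambda>n. (z n, s)) \<longlonglongrightarrow> (fst p, s)" by (intro tendsto_intros zl)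
      ultimately have "\<forall>\<^sub>F n in sequentially. (z n, s) \<in> - E"
        using clE by (intro topological_tendstoD) auto
      then obtain N where "\<And>n. n \<ge> N \<Longrightarrow> (z n, s) \<notin> E" by (auto simp: eventually_sequentially)
      moreover have "s \<in> B N" using s by blast
      ultimately show False by (auto simp: B_def S_def)
    qed
  qed
  then have "emeasure lborel (\<Inter>n. B n) \<le> emeasure lborel (S (fst p))"
    using Sb by (intro emeasure_mono) auto
  moreover have "ennreal (2 * \<bar>snd p\<bar>) \<le> emeasure lborel (\<Inter>n. B n)"
  proof (rule LIMSEQ_le[OF _ lB])
    show "(\<lambda>n. ennreal (2 * \<bar>snd (x n)\<bar>)) \<longlonglongrightarrow> ennreal (2 * \<bar>snd p\<bar>)"
      by (intro tendsto_intros lim)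
    have "ennreal (2 * \<bar>snd (x n)\<bar>) \<le> emeasure lborel (B n)" for n
    proof -
      have "ennreal (2 * \<bar>snd (x n)\<bar>) \<le> leb_outer (S (z n))"
        using x[of n] by (auto simp: steiner_def z_def S_def)
      also have "\<dots> = emeasure lborel (S (z n))" by (rule leb_outer_borel[OF Sb])
      also have "\<dots> \<le> emeasure lborel (B n)"
        using Bb by (intro emeasure_mono) (auto simp: B_def)
      finally show ?thesis .
    qed
    then show "\<exists>N. \<forall>n\<ge>N. ennreal (2 * \<bar>snd (x n)\<bar>) \<le> emeasure lborel (B n)" by blast
  qed
  ultimately have "ennreal (2 * \<bar>snd p\<bar>) \<le> leb_outer (S (fst p))"
    unfolding leb_outer_borel[OF Sb] by (rule order_trans[rotated])
  then show "p \<in> steiner E"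
    using pE by (cases p) (simp add: steiner_def S_def)
qed

lemma emeasure_lborel_slices:
  fixes A :: "('a::euclidean_space \<times> 'b::euclidean_space) set"
  assumes "A \<in> sets borel"
  shows "emeasure lborel A = (\<integral>\<^sup>+x. emeasure lborel {y. (x, y) \<in> A} \<partial>lborel)"
proof -
  have "emeasure (lborel \<Otimes>\<^sub>M lborel) A = (\<integral>\<^sup>+x. emeasure lborel (Pair x -` A) \<partial>lborel)"
  proof (rule lborel.emeasure_pair_measure_alt)
    show "A \<in> sets (lborel \<Otimes>\<^sub>M lborel)" unfolding lborel_prod using assms by simp
  qed
  then show ?thesis by (simp add: lborel_prod vimage_def)
qed

text \<open>Cavalieri's principle: over each base point the symmetrized slice is a centred interval
  as long as the measure of the original slice, which is finite because \<open>E\<close> is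
  bounded.\<close>

lemma emeasure_steiner:
  fixes E :: "'n::finite heis set"
  assumes E: "compact E"
  shows "emeasure lborel (steiner E) = emeasure lborel E"
proof -
  have clE: "closed E" using E by (rule compact_imp_closed)
  have "emeasure lborel {t. (z, t) \<in> steiner E} = emeasure lborel {s. (z, s) \<in> E}" for z
  proof (cases "z \<in> fst ` E")
    case False
    then have "{t. (z, t) \<in> steiner E} = {}" "{s. (z, s) \<in> E} = {}"
      by (force simp: steiner_def)+
    then show ?thesis by simp
  next
    case True
    have Sb: "{s. (z, s) \<in> E} \<in> sets borel" using slice_closed[OF clE] by (rule borel_closed)
    have "bounded {s. (z, s) \<in> E}"
      using bounded_snd[OF compact_imp_bounded[OF E]] by (rule bounded_subset) force
    then have "emeasure lborel {s. (z, s) \<in> E} < \<infinity>" by (rule emeasure_bounded_finite)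
    then obtain l where l: "0 \<le> l" "emeasure lborel {s. (z, s) \<in> E} = ennreal l"
      by (cases "emeasure lborel {s. (z, s) \<in> E}") auto
    have "{t. (z, t) \<in> steiner E} = {- l / 2..l / 2}"
      using True l by (auto simp: steiner_def leb_outer_borel[OF Sb] ennreal_le_iff abs_le_iff)
    then show ?thesis using l by simp
  qed
  then show ?thesis
    using clE closed_steiner[OF E] by (simp add: emeasure_lborel_slices borel_closed)
qed

section \<open>Comparison of measures and the equality case\<close>

lemma emeasure_A_set_pos:
  assumes "0 < lam"
  shows "0 < emeasure lborel (A_set lam :: 'n::finite heis set)"
proof (rule ccontr)
  assume "\<not> ?thesis"
  then have "A_set lam \<in> null_sets (lborel :: 'n heis measure)"
    using borel_compact[OF compact_A_set[OF assms]] by (auto simp: null_sets_def)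
  then have "negligible (A_set lam :: 'n heis set)"
    by (simp add: negligible_iff_null_sets null_sets_completionI)
  then have "negligible (interior (A_set lam :: 'n heis set))"
    using interior_subset negligible_subset by blast
  then show False
    using interior_A_set_nonempty[OF assms] open_not_negligible[OF open_interior] by blast
qed

text \<open>\<open>A_set lam\<close> is itself a competitor in the supremum, with diameter
  \<open>lam\<close>.\<close>

lemma emeasure_A_set_le:
  assumes lam: "0 < lam"
  shows "emeasure lborel (A_set lam :: 'n::finite heis set) \<le> C_IR TYPE('n) * ennreal lam ^ (2 * CARD('n) + 2)"
proof -
  let ?A = "A_set lam :: 'n heis set"
  have "leb_outer ?A / cc_diam ?A ^ (2 * CARD('n) + 2) \<le> C_IR TYPE('n)"
    unfolding C_IR_def
    by (rule SUP_upper) (use lam in \<open>simp add: A_set_rot_invariant cc_diam_A_set\<close>)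
  then have "emeasure lborel ?A / ennreal lam ^ (2 * CARD('n) + 2) \<le> C_IR TYPE('n)"
    using borel_compact[OF compact_A_set[OF lam, where 'n = 'n]] by (simp only: leb_outer_borel cc_diam_A_set[OF lam])
  then have "emeasure lborel ?A / ennreal lam ^ (2 * CARD('n) + 2) * ennreal lam ^ (2 * CARD('n) + 2)
      \<le> C_IR TYPE('n) * ennreal lam ^ (2 * CARD('n) + 2)"
    by (rule mult_right_mono) simp
  moreover have "ennreal lam ^ (2 * CARD('n) + 2) / ennreal lam ^ (2 * CARD('n) + 2) = 1"
    using lam unfolding ennreal_power[OF less_imp_le[OF lam]] by (intro ennreal_divide_self) auto
  ultimately show ?thesis by (simp only: ennreal_divide_times mult_1_right)
qed

theorem theorem4p4:
  fixes E :: "'n::finite heis set"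
  assumes "E \<in> isodiametric_rot"
  shows "steiner E \<in> isodiametric_rot \<and> steiner E = A_set (enn2real (cc_diam E))"
proof -
  let ?Q = "2 * CARD('n) + 2"
  have rE: "E \<in> rot_invariant" and cE: "compact E" and dE: "0 < cc_diam E"
    and mE': "leb_outer E = C_IR TYPE('n) * cc_diam E ^ ?Q"
    using assms by (auto simp: isodiametric_rot_def)
  have mE: "emeasure lborel E = C_IR TYPE('n) * cc_diam E ^ ?Q"
    using mE' leb_outer_borel[OF borel_compact[OF cE]] by simp
  have fE: "emeasure lborel E < \<infinity>" by (rule emeasure_bounded_finite[OF compact_imp_bounded[OF cE]])
  \<comment> \<open>The set \<open>A_set 1\<close> has positive measure, so the isodiametric
    constant is positive.\<close>
  have "0 < C_IR TYPE('n) * ennreal 1 ^ ?Q"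
    using emeasure_A_set_pos[of 1, where 'n = 'n] emeasure_A_set_le[of 1, where 'n = 'n] by (auto intro: less_le_trans)
  then have C: "0 < C_IR TYPE('n)" by simp
  \<comment> \<open>An infinite diameter would, with a positive constant, force infinite measure on
    the compact set \<open>E\<close>.\<close>
  have "cc_diam E \<noteq> \<infinity>"
  proof
    assume "cc_diam E = \<infinity>"
    then have "emeasure lborel E = \<infinity>" using mE C by (simp add: ennreal_mult_top)
    then show False using fE by simp
  qed
  define lam where "lam = enn2real (cc_diam E)"
  have dlam: "cc_diam E = ennreal lam" using \<open>cc_diam E \<noteq> \<infinity>\<close> by (simp add: lam_def less_top)
  have lam: "0 < lam" using dE by (simp add: dlam)
  let ?A = "A_set lam :: 'n heis set"
  have sub: "steiner E \<subseteq> ?A" using rE dlam lam by (intro steiner_subset_A_set) auto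
  \<comment> \<open>Maximality of \<open>E\<close> enters here: \<open>A_set lam\<close> has at most
    the extremal measure for diameter \<open>lam\<close>, which is attained by \<open>E\<close> and
    preserved by symmetrization.\<close>
  have le: "emeasure lborel ?A \<le> emeasure lborel (steiner E)"
    using emeasure_A_set_le[OF lam, where 'n = 'n] by (simp add: emeasure_steiner[OF cE] mE dlam)
  have clS: "closed (steiner E)" by (rule closed_steiner[OF cE])
  have bA: "?A \<in> sets borel" by (rule borel_compact[OF compact_A_set[OF lam]])
  have fS: "emeasure lborel (steiner E) \<noteq> \<infinity>" using fE by (simp add: emeasure_steiner[OF cE])
  have "emeasure lborel (?A - steiner E) = emeasure lborel ?A - emeasure lborel (steiner E)"
    using bA clS fS sub by (intro emeasure_Diff) (auto intro: borel_closed)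
  also have "\<dots> = 0"
    using le emeasure_bounded_finite[OF compact_imp_bounded[OF compact_A_set[OF lam]]]
    by (simp add: diff_eq_0_iff_ennreal)
  finally have "?A - steiner E \<in> null_sets lborel"
    using bA clS by (auto simp: null_sets_def intro: borel_closed)
  then have "negligible (?A - steiner E)"
    by (simp add: negligible_iff_null_sets null_sets_completionI)
  \<comment> \<open>An open set minus a closed one is open, and a negligible open set is empty; so
    \<open>steiner E\<close> contains the interior of \<open>A_set lam\<close> and, being closed,
    its closure.\<close>
  then have "negligible (interior ?A - steiner E)"
    using interior_subset by (metis Diff_mono negligible_subset order_refl)
  then have "interior ?A - steiner E = {}"
    using open_not_negligible[OF open_Diff[OF open_interior clS]] by blast
  then have "closure (interior ?A) \<subseteq> steiner E" using clS by (intro closure_minimal) auto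
  moreover have "closure (interior ?A) = closure ?A"
    by (rule convex_closure_interior[OF convex_A_set[OF lam] interior_A_set_nonempty[OF lam]])
  ultimately have eq: "steiner E = ?A" using sub closure_subset by blast
  have "leb_outer (steiner E) = C_IR TYPE('n) * cc_diam (steiner E) ^ ?Q"
    unfolding leb_outer_borel[OF borel_closed[OF clS]] emeasure_steiner[OF cE] mE
    by (simp only: eq cc_diam_A_set[OF lam] dlam)
  then have "steiner E \<in> isodiametric_rot"
    using lam by (simp add: isodiametric_rot_def eq A_set_rot_invariant compact_A_set cc_diam_A_set)
  with eq show ?thesis by (simp add: lam_def)
qed

end
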